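(* The group $H$ does not contain any non-abelian free subgroup. Consequently, for every subring $A<\mathbb{R}$, the group $H(A)$ contains no non-abelian free subgroup.
   Context: Let $\mathbb{P}^1=\mathbb{P}^1(\mathbb{R})$ be the real projective line with its usual topology (a circle), with the natural action of $\mathrm{PSL}_2(\mathbb{R})$. Let $G$ be the group of all homeomorphisms of $\mathbb{P}^1$ which are piecewise in $\mathrm{PSL}_2(\mathbb{R})$ with finitely many pieces, each piece an interval of $\mathbb{P}^1$. Let $\infty\in\mathbb{P}^1$ be the point corresponding to the first basis vector of $\mathbb{R}^2$, and $H<G$ its stabilizer. For a subring $A<\mathbb{R}$, $P_A\subseteq\mathbb{P}^1$ is the set of fixed points of hyperbolic elements of $\mathrm{PSL}_2(A)$, $G(A)$ is the subgroup of $G$ of elements piecewise in $\mathrm{PSL}_2(A)$ with all interval endpoints in $P_A$, and $H(A)=G(A)\cap H$. *)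

theory Defs
  imports "HOL-Analysis.Analysis"
begin

text \<open>The real projective line modelled as the one-point compactification of the reals:
  Some t is the point [t:1], None is the point [1:0] (the first basis vector), i.e. infinity.\<close>
type_synonym P1 = "real option"

definition P1_open :: "P1 set \<Rightarrow> bool" where
  "P1_open U \<longleftrightarrow> open {x. Some x \<in> U} \<and>
     (None \<in> U \<longrightarrow> (\<exists>R. \<forall>x. R < \<bar>x\<bar> \<longrightarrow> Some x \<in> U))"

definition P1_top :: "P1 topology" where
  "P1_top = topology P1_open"

text \<open>Projective action of the matrix (a b; c d) on [x:y], i.e. [ax+by : cx+dy].\<close>
definition mob :: "real \<Rightarrow> real \<Rightarrow> real \<Rightarrow> real \<Rightarrow> P1 \<Rightarrow> P1" where
  "mob a b c d p = (case p of
      None \<Rightarrow> (if c = 0 then None else Some (a / c))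
    | Some t \<Rightarrow> (if c * t + d = 0 then None else Some ((a * t + b) / (c * t + d))))"

text \<open>G: homeomorphisms of P1 that are piecewise in PSL2(R) on finitely many intervals
  (intervals of the circle = connected subsets).\<close>
definition G :: "(P1 \<Rightarrow> P1) set" where
  "G = {f. homeomorphic_map P1_top P1_top f \<and>
      (\<exists>\<I>. finite \<I> \<and> \<Union>\<I> = UNIV \<and>
         (\<forall>I\<in>\<I>. connectedin P1_top I \<and>
            (\<exists>a b c d. a * d - b * c = 1 \<and> (\<forall>x\<in>I. f x = mob a b c d x))))}"

definition H :: "(P1 \<Rightarrow> P1) set" where
  "H = {f \<in> G. f None = None}"

definition is_subring :: "real set \<Rightarrow> bool" where
  "is_subring A \<longleftrightarrow> 1 \<in> A \<and> (\<forall>x\<in>A. \<forall>y\<in>A. x - y \<in> A \<and> x * y \<in> A)"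

definition P_ring :: "real set \<Rightarrow> P1 set" where
  "P_ring A = {p. \<exists>a b c d. a \<in> A \<and> b \<in> A \<and> c \<in> A \<and> d \<in> A \<and> a * d - b * c = 1 \<and>
                   \<bar>a + d\<bar> > 2 \<and> mob a b c d p = p}"

definition G_ring :: "real set \<Rightarrow> (P1 \<Rightarrow> P1) set" where
  "G_ring A = {f. homeomorphic_map P1_top P1_top f \<and>
      (\<exists>\<I>. finite \<I> \<and> \<Union>\<I> = UNIV \<and>
         (\<forall>I\<in>\<I>. connectedin P1_top I \<and> P1_top frontier_of I \<subseteq> P_ring A \<and>
            (\<exists>a b c d. a \<in> A \<and> b \<in> A \<and> c \<in> A \<and> d \<in> A \<and> a * d - b * c = 1 \<and>
               (\<forall>x\<in>I. f x = mob a b c d x))))}"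

definition H_ring :: "real set \<Rightarrow> (P1 \<Rightarrow> P1) set" where
  "H_ring A = G_ring A \<inter> H"

fun word_eval :: "(('a \<Rightarrow> 'a) \<times> bool) list \<Rightarrow> 'a \<Rightarrow> 'a" where
  "word_eval [] = id"
| "word_eval ((s, e) # w) = (if e then s else inv s) \<circ> word_eval w"

fun reduced_word :: "(('a \<Rightarrow> 'a) \<times> bool) list \<Rightarrow> bool" where
  "reduced_word (x # y # w) = ((fst x = fst y \<longrightarrow> snd x = snd y) \<and> reduced_word (y # w))"
| "reduced_word _ = True"

definition free_basis :: "('a \<Rightarrow> 'a) set \<Rightarrow> bool" where
  "free_basis S \<longleftrightarrow> (\<forall>w. w \<noteq> [] \<and> fst ` set w \<subseteq> S \<and> reduced_word w \<longrightarrow> word_eval w \<noteq> id)"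

definition has_nonabelian_free_subgroup :: "('a \<Rightarrow> 'a) set \<Rightarrow> bool" where
  "has_nonabelian_free_subgroup K \<longleftrightarrow>
     (\<exists>S \<subseteq> K. (\<exists>s\<in>S. \<exists>t\<in>S. s \<noteq> t) \<and> free_basis S)"

end

theory Submission
  imports Defs
begin

text \<open>
  An element of \<open>H\<close> acts on the real line as an increasing piecewise projective homeomorphism.
  At a common fixed point of two elements \<open>f\<close>, \<open>g\<close>, and at both infinities, the one-sided germs
  of \<open>f\<close> and \<open>g\<close> are simultaneously conjugate to affine maps, so every element of the second
  derived subgroup of the group generated by them is trivial near the common fixed points and near
  infinity. Take such an element \<open>u \<noteq> 1\<close> and the leftmost interval between common fixed points
  that it moves. Its support there lies in a compact set \<open>[m, M]\<close> without common fixed points,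
  so some \<open>c\<close> in the group moves \<open>m\<close> beyond \<open>M\<close>, and \<open>u\<close> and \<open>c u c^-1\<close> have disjoint supports on this
  interval. If they commuted everywhere, freeness would force \<open>c u c^-1\<close> to be \<open>u\<close> or \<open>u^-1\<close>, which
  is absurd; hence their commutator is again nontrivial, but it moves fewer intervals. Only
  finitely many intervals are available, so the group is not free.
\<close>

section \<open>Words in two letters\<close>

text \<open>The letter \<open>(i, e)\<close> is the first generator if \<open>i\<close> holds and the second otherwise, inverted
  unless \<open>e\<close> holds.\<close>
definition ev :: "('a \<Rightarrow> 'a) \<Rightarrow> ('a \<Rightarrow> 'a) \<Rightarrow> (bool \<times> bool) list \<Rightarrow> 'a \<Rightarrow> 'a" where
  "ev f g w = word_eval (map (\<lambda>(i, e). (if i then f else g, e)) w)"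

text \<open>\<open>reduced_word\<close> on abstract letters: the same word can then be evaluated in
  different pairs of maps and the results compared.\<close>

fun reduced :: "(bool \<times> bool) list \<Rightarrow> bool" where
  "reduced (x # y # w) \<longleftrightarrow> (fst x = fst y \<longrightarrow> snd x = snd y) \<and> reduced (y # w)"
| "reduced _ \<longleftrightarrow> True"

definition winv :: "(bool \<times> bool) list \<Rightarrow> (bool \<times> bool) list" where
  "winv w = rev (map (\<lambda>(i, e). (i, \<not> e)) w)"

text \<open>Bijectivity is included because the letters use \<open>inv\<close>, which is a genuine
  inverse only for bijections.\<close>

definition free_pair :: "('a \<Rightarrow> 'a) \<Rightarrow> ('a \<Rightarrow> 'a) \<Rightarrow> bool" where
  "free_pair f g \<longleftrightarrow> bij f \<and> bij g \<and> (\<forall>w. w \<noteq> [] \<and> reduced w \<longrightarrow> ev f g w \<noteq> id)"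

lemma ev_Nil [simp]: "ev f g [] = id"
  by (simp add: ev_def)

lemma ev_Cons: "ev f g ((i, e) # w) =
    (if e then (if i then f else g) else inv (if i then f else g)) \<circ> ev f g w"
  by (simp add: ev_def)

lemma ev_append: "ev f g (u @ v) = ev f g u \<circ> ev f g v"
  by (induction u) (auto simp: ev_Cons o_assoc)

lemma bij_ev: "bij f \<Longrightarrow> bij g \<Longrightarrow> bij (ev f g w)"
  by (induction w) (auto simp: ev_Cons intro!: bij_comp bij_imp_bij_inv)

lemma ev_inverse_letters:
  assumes "bij f" "bij g"
  shows "ev f g [(i, e), (i, \<not> e)] = id"
  using assms by (cases e; cases i) (simp_all add: ev_Cons bij_is_inj bij_is_surj surj_iff[THEN iffD1])

lemma ev_winv:
  assumes "bij f" "bij g"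
  shows "ev f g (winv w) = inv (ev f g w)"
proof -
  have "ev f g w \<circ> ev f g (winv w) = id"
  proof (induction w)
    case Nil
    show ?case by (simp add: winv_def)
  next
    case (Cons x w)
    obtain i e where x: "x = (i, e)" by force
    have "ev f g (x # w) \<circ> ev f g (winv (x # w)) =
        ev f g [x] \<circ> (ev f g w \<circ> ev f g (winv w)) \<circ> ev f g [(i, \<not> e)]"
      using ev_append[of f g "[x]" w] ev_append[of f g "winv w" "[(i, \<not> e)]"]
      by (simp add: winv_def x o_assoc)
    also have "\<dots> = ev f g ([x] @ [(i, \<not> e)])"
      by (simp only: Cons ev_append comp_id)
    also have "\<dots> = id"
      using ev_inverse_letters[OF assms, of i e] by (simp add: x)
    finally show ?case .
  qed
  moreover have "inv (ev f g w) \<circ> (ev f g w \<circ> ev f g (winv w)) = ev f g (winv w)"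
    using bij_is_inj[OF bij_ev[OF assms]] by (simp add: o_assoc)
  ultimately show ?thesis by simp
qed

lemma not_reduced_split: "\<not> reduced w \<Longrightarrow> \<exists>u i e v. w = u @ [(i, e), (i, \<not> e)] @ v"
proof (induction w rule: reduced.induct)
  case (1 x y w)
  show ?case
  proof (cases "reduced (y # w)")
    case True
    with 1 have "fst x = fst y" "snd y = (\<not> snd x)" by auto
    then have "x # y # w = [] @ [(fst x, snd x), (fst x, \<not> snd x)] @ w"
      by (cases x; cases y) simp
    then show ?thesis by blast
  next
    case False
    then obtain u i e v where "y # w = u @ [(i, e), (i, \<not> e)] @ v" using 1 by blast
    then have "x # y # w = (x # u) @ [(i, e), (i, \<not> e)] @ v" by simp
    then show ?thesis by blast
  qed
qed auto

text \<open>Deleting a letter next to its inverse changes neither evaluation, so both sides come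
  down to a reduced word, where freeness leaves only the empty one. Relations may hence be checked
  in any convenient free pair.\<close>

lemma free_pair_transfer:
  fixes f g :: "'a \<Rightarrow> 'a" and f' g' :: "'b \<Rightarrow> 'b"
  assumes "free_pair f g" "free_pair f' g'"
  shows "ev f g w = id \<longleftrightarrow> ev f' g' w = id"
proof (induction "length w" arbitrary: w rule: less_induct)
  case less
  have b: "bij f" "bij g" "bij f'" "bij g'" using assms by (auto simp: free_pair_def)
  show ?case
  proof (cases "reduced w")
    case True
    then show ?thesis using assms by (cases "w = []") (auto simp: free_pair_def)
  next
    case False
    then obtain u i e v where w: "w = u @ [(i, e), (i, \<not> e)] @ v" using not_reduced_split by blast
    have "ev f g w = ev f g (u @ v)" "ev f' g' w = ev f' g' (u @ v)"
      unfolding w ev_append ev_inverse_letters[OF b(1,2)] ev_inverse_letters[OF b(3,4)] by simp_all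
    then show ?thesis using less[of "u @ v"] by (simp add: w)
  qed
qed

section \<open>Commuting conjugates in free groups\<close>

text \<open>A free group on two letters is compared with Sanov's group of integer matrices, where
  commutation is linear algebra.\<close>

definition lin :: "int \<Rightarrow> int \<Rightarrow> int \<Rightarrow> int \<Rightarrow> int \<times> int \<Rightarrow> int \<times> int" where
  "lin p q r s = (\<lambda>(x, y). (p * x + q * y, r * x + s * y))"

lemma lin_comp: "lin p q r s \<circ> lin p' q' r' s' =
    lin (p * p' + q * r') (p * q' + q * s') (r * p' + s * r') (r * q' + s * s')"
  by (auto simp: lin_def fun_eq_iff algebra_simps)

lemma lin_eq_iff: "lin p q r s = lin p' q' r' s' \<longleftrightarrow> p = p' \<and> q = q' \<and> r = r' \<and> s = s'"
proof
  assume "lin p q r s = lin p' q' r' s'"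
  from fun_cong[OF this, of "(1, 0)"] fun_cong[OF this, of "(0, 1)"]
  show "p = p' \<and> q = q' \<and> r = r' \<and> s = s'" by (simp add: lin_def)
qed simp

lemma lin_id: "lin 1 0 0 1 = id"
  by (auto simp: lin_def)

lemma
  assumes "p * s - q * r = 1"
  shows bij_lin: "bij (lin p q r s)" and inv_lin: "inv (lin p q r s) = lin s (- q) (- r) p"
proof -
  have 1: "lin p q r s \<circ> lin s (- q) (- r) p = id" "lin s (- q) (- r) p \<circ> lin p q r s = id"
    unfolding lin_comp lin_id[symmetric] lin_eq_iff using assms by (auto simp: algebra_simps)
  then show "bij (lin p q r s)" using o_bij by blast
  show "inv (lin p q r s) = lin s (- q) (- r) p"
    using 1 by (rule inv_unique_comp)
qed

abbreviation sanov_a :: "int \<times> int \<Rightarrow> int \<times> int" where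
  "sanov_a \<equiv> lin 1 2 0 1"

abbreviation sanov_b :: "int \<times> int \<Rightarrow> int \<times> int" where
  "sanov_b \<equiv> lin 1 0 2 1"

lemma sanov_letter:
  "ev sanov_a sanov_b [(i, e)] =
     lin 1 (if i then if e then 2 else - 2 else 0) (if i then 0 else if e then 2 else - 2) 1"
  by (cases i; cases e) (simp_all add: ev_Cons inv_lin)

lemma ev_sanov_lin: "\<exists>p q r s. ev sanov_a sanov_b w = lin p q r s \<and> p * s - q * r = 1"
proof (induction w)
  case Nil
  have "ev sanov_a sanov_b [] = lin 1 0 0 1 \<and> 1 * 1 - 0 * 0 = (1::int)" by (simp add: lin_id)
  then show ?case by blast
next
  case (Cons x w)
  obtain i e where x: "x = (i, e)" by force
  obtain p q r s where w: "ev sanov_a sanov_b w = lin p q r s" "p * s - q * r = 1"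
    using Cons by blast
  have "ev sanov_a sanov_b (x # w) = ev sanov_a sanov_b [x] \<circ> ev sanov_a sanov_b w"
    using ev_append[of _ _ "[x]" w] by simp
  also have "\<dots> = lin (p + (if i then if e then 2 else - 2 else 0) * r)
      (q + (if i then if e then 2 else - 2 else 0) * s)
      ((if i then 0 else if e then 2 else - 2) * p + r)
      ((if i then 0 else if e then 2 else - 2) * q + s)"
    unfolding x w(1) sanov_letter lin_comp by simp
  finally show ?case
    using w(2) by (intro exI conjI) (assumption, auto simp: algebra_simps)
qed

section \<open>Ping-pong for Sanov's matrices\<close>

text \<open>The four ping-pong regions of the plane; the letter applied last determines the region.\<close>
definition region :: "bool \<times> bool \<Rightarrow> (int \<times> int) set" where
  "region l = {(x, y). (if fst l then \<bar>y\<bar> < \<bar>x\<bar> else \<bar>x\<bar> < \<bar>y\<bar>) \<and>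
     (if snd l then 0 < x * y else x * y < 0)}"

text \<open>The one inequality behind the ping-pong; all four letters reduce to it by exchanging the
  coordinates or changing a sign.\<close>

lemma shear_region:
  fixes x y :: int
  assumes "y \<noteq> 0" "\<bar>x\<bar> < \<bar>y\<bar> \<or> 0 < x * y"
  shows "\<bar>y\<bar> < \<bar>x + 2 * y\<bar>" "0 < (x + 2 * y) * y"
proof -
  have "\<bar>y\<bar> < \<bar>x + 2 * y\<bar> \<and> 0 < (x + 2 * y) * y"
  proof (cases "0 < y")
    case True
    then have "- y < x" using assms(2) by (auto simp: zero_less_mult_iff)
    then have "y < x + 2 * y" by simp
    with True show ?thesis by (simp add: zero_less_mult_iff)
  next
    case False
    with assms(1) have y: "y < 0" by simp
    then have "x < - y" using assms(2) by (auto simp: zero_less_mult_iff)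
    then have "x + 2 * y < y" by simp
    with y show ?thesis by (simp add: zero_less_mult_iff)
  qed
  then show "\<bar>y\<bar> < \<bar>x + 2 * y\<bar>" "0 < (x + 2 * y) * y" by auto
qed

text \<open>The first hypothesis says that \<open>l'\<close> is not the inverse of \<open>l\<close>;
  such a shear pushes the vector into its own region.\<close>

lemma letter_region:
  assumes "fst l' = fst l \<longrightarrow> snd l' = snd l" "z \<in> region l"
  shows "ev sanov_a sanov_b [l'] z \<in> region l'"
proof -
  obtain x y where z: "z = (x, y)" by force
  obtain i e where l: "l' = (i, e)" by force
  have ne: "x \<noteq> 0" "y \<noteq> 0"
    using assms(2) by (auto simp: region_def z split: if_splits)
  have 1: "i \<Longrightarrow> \<bar>x\<bar> < \<bar>y\<bar> \<or> (if e then 0 < x * y else 0 < - x * y)"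
    using assms by (auto simp: region_def z l split: if_splits)
  have 2: "\<not> i \<Longrightarrow> \<bar>y\<bar> < \<bar>x\<bar> \<or> (if e then 0 < y * x else 0 < - y * x)"
    using assms by (auto simp: region_def z l mult.commute split: if_splits)
  show ?thesis
  proof (cases i; cases e)
    assume "i" "e"
    then show ?thesis using shear_region[of y x] 1 ne
      unfolding l z sanov_letter by (simp add: region_def lin_def)
  next
    assume "i" "\<not> e"
    moreover have "\<bar>x - 2 * y\<bar> = \<bar>- x + 2 * y\<bar>" by simp
    ultimately show ?thesis using shear_region[of y "- x"] 1 ne
      unfolding l z sanov_letter by (simp add: region_def lin_def algebra_simps)
  next
    assume "\<not> i" "e"
    then show ?thesis using shear_region[of x y] 2 ne
      unfolding l z sanov_letter by (simp add: region_def lin_def algebra_simps)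
  next
    assume "\<not> i" "\<not> e"
    moreover have "\<bar>y - 2 * x\<bar> = \<bar>- y + 2 * x\<bar>" by simp
    ultimately show ?thesis using shear_region[of x "- y"] 2 ne
      unfolding l z sanov_letter by (simp add: region_def lin_def algebra_simps)
  qed
qed

text \<open>The starting point is the basis vector not fixed by the letter applied first: that
  letter moves it into a region, and \<open>letter_region\<close> carries it on.\<close>

lemma sanov_ping_pong:
  assumes "w \<noteq> []" "reduced w"
  shows "ev sanov_a sanov_b w (if fst (last w) then (0, 1) else (1, 0)) \<in> region (hd w)"
  using assms
proof (induction w rule: reduced.induct)
  case (1 x y w)
  have "ev sanov_a sanov_b (x # y # w) = ev sanov_a sanov_b [x] \<circ> ev sanov_a sanov_b (y # w)"
    using ev_append[of _ _ "[x]" "y # w"] by simp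
  then show ?case using 1 letter_region[of x y] by simp
next
  case ("2_2" x)
  obtain i e where "x = (i, e)" by force
  then show ?case
    by (cases i; cases e) (simp_all add: sanov_letter, simp_all add: lin_def region_def)
qed simp

lemma free_pair_sanov: "free_pair sanov_a sanov_b"
proof -
  have "ev sanov_a sanov_b w \<noteq> id" if "w \<noteq> []" "reduced w" for w
    using sanov_ping_pong[OF that] by (auto simp: region_def split: if_splits)
  then show ?thesis by (auto simp: free_pair_def bij_lin)
qed

text \<open>A scalar matrix keeps the starting basis vector on its axis, whereas all regions avoid
  the axes. This also excludes -1, which commutes with everything.\<close>

lemma sanov_not_scalar:
  assumes "ev sanov_a sanov_b w \<noteq> id"
  shows "ev sanov_a sanov_b w \<noteq> lin p 0 0 p"
  using assms
proof (induction "length w" arbitrary: w rule: less_induct)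
  case less
  show ?case
  proof (cases "reduced w")
    case True
    have "w \<noteq> []" using less.prems by auto
    from sanov_ping_pong[OF this True] show ?thesis
      by (auto simp: region_def lin_def split: if_splits)
  next
    case False
    then obtain u i e v where w: "w = u @ [(i, e), (i, \<not> e)] @ v" using not_reduced_split by blast
    have "ev sanov_a sanov_b w = ev sanov_a sanov_b (u @ v)"
      unfolding w ev_append by (subst ev_inverse_letters) (auto simp: bij_lin)
    then show ?thesis using less by (simp add: w)
  qed
qed

section \<open>Commuting conjugates among integer matrices\<close>

text \<open>The kernel of the nilpotent matrix \<open>(n, q; r, -n)\<close> is spanned by a primitive integer vector. The
  conjugating matrix maps it to a multiple of itself, and integrality forces the factor to be a unit.\<close>
lemma nilpotent_conj:
  fixes n q r n' q' r' a b c d :: int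
  assumes det: "a * d - b * c = 1"
    and nil: "n * n + q * r = 0" and ne: "\<not> (n = 0 \<and> q = 0 \<and> r = 0)"
    and par: "n' * q = n * q'" "n' * r = n * r'" "q' * r = q * r'"
    and conj: "n' * a + q' * c = a * n + b * r" "n' * b + q' * d = a * q - b * n"
      "r' * a - n' * c = c * n + d * r" "r' * b - n' * d = c * q - d * n"
  shows "n' = n \<and> q' = q \<and> r' = r"
proof -
  have "\<exists>X Y. (X \<noteq> 0 \<or> Y \<noteq> 0) \<and> n * X + q * Y = 0 \<and> r * X - n * Y = 0"
  proof (cases "n = 0 \<and> r = 0")
    case True
    then show ?thesis using ne by (intro exI[of _ 1] exI[of _ 0]) auto
  next
    case False
    then show ?thesis using nil by (intro exI[of _ n] exI[of _ r]) auto
  qed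
  then obtain X Y where XY: "X \<noteq> 0 \<or> Y \<noteq> 0" "n * X + q * Y = 0" "r * X - n * Y = 0"
    by blast
  define x where "x = X div gcd X Y"
  define y where "y = Y div gcd X Y"
  have g: "gcd X Y \<noteq> 0" "X = gcd X Y * x" "Y = gcd X Y * y"
    using XY(1) by (auto simp: x_def y_def)
  have cop: "coprime x y" unfolding x_def y_def using XY(1) by (rule div_gcd_coprime)
  have "gcd X Y * (n * x + q * y) = 0" "gcd X Y * (r * x - n * y) = 0"
    using XY(2,3) g(2,3) by (metis distrib_left mult.left_commute,
      metis right_diff_distrib mult.left_commute)
  then have v: "n * x + q * y = 0" "r * x - n * y = 0" using g(1) by auto
  have v0: "x \<noteq> 0 \<or> y \<noteq> 0" using cop by auto
  have v': "n' * x + q' * y = 0" "r' * x - n' * y = 0"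
  \<comment> \<open>The two trace-free matrices are proportional, so they kill the same
    vector.\<close>
  proof -
    have "n * (n' * x + q' * y) = 0" "q * (n' * x + q' * y) = 0" "r * (n' * x + q' * y) = 0"
      "n * (r' * x - n' * y) = 0" "q * (r' * x - n' * y) = 0" "r * (r' * x - n' * y) = 0"
      using v par nil by algebra+
    then show "n' * x + q' * y = 0" "r' * x - n' * y = 0" using ne by auto
  qed
  have ne': "\<not> (n' = 0 \<and> q' = 0 \<and> r' = 0)"
  proof
    assume "n' = 0 \<and> q' = 0 \<and> r' = 0"
    with conj have "a * n + b * r = 0" "a * q - b * n = 0" "c * n + d * r = 0" "c * q - d * n = 0"
      by auto
    then have "n = 0" "q = 0" "r = 0" using det by algebra+
    with ne show False by simp
  qed
  define x' where "x' = a * x + b * y"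
  define y' where "y' = c * x + d * y"
  have im: "n' * x' + q' * y' = 0" "r' * x' - n' * y' = 0"
    unfolding x'_def y'_def using conj v by algebra+
  \<comment> \<open>The second matrix kills both (x, y) and its image under the conjugator; being
    nonzero, it forces the two to be parallel.\<close>
  have "n' * (x' * y - y' * x) = 0" "q' * (x' * y - y' * x) = 0" "r' * (x' * y - y' * x) = 0"
    using im v' by algebra+
  then have cross: "x' * y = y' * x" using ne' by auto
  obtain \<alpha> \<beta> where bez: "\<alpha> * x + \<beta> * y = 1"
    using cop bezout_int[of x y] by (auto simp: coprime_iff_gcd_eq_1)
  define l where "l = \<alpha> * x' + \<beta> * y'"
  have l: "a * x + b * y = l * x" "c * x + d * y = l * y"
    unfolding l_def x'_def[symmetric] y'_def[symmetric] using cross bez by algebra+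
  \<comment> \<open>\<open>l\<close> and \<open>a + d - l\<close> are the eigenvalues of a matrix of
    determinant 1; both are integers, so they are the same unit.\<close>
  have "x * (l * (a + d - l) - 1) = 0" "y * (l * (a + d - l) - 1) = 0"
    using l det by algebra+
  then have l1: "l * (a + d - l) = 1" using v0 by auto
  then have l2: "l * l = 1" "a + d - l = l" by (auto simp: zmult_eq_1_iff)
  \<comment> \<open>The conjugator acts by \<open>l\<close> on the line of (x, y) and modulo it, and
    this line is kernel and image of the nilpotent matrix; so multiplication by the conjugator on
    either side gives the factor \<open>l\<close>.\<close>
  have "x * (n * a + q * c - l * n) = 0" "y * (n * a + q * c - l * n) = 0"
    "x * (n * b + q * d - l * q) = 0" "y * (n * b + q * d - l * q) = 0"
    "x * (r * a - n * c - l * r) = 0" "y * (r * a - n * c - l * r) = 0"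
    "x * (r * b - n * d + l * n) = 0" "y * (r * b - n * d + l * n) = 0"
    using v l l2 det by algebra+
  then have NG: "n * a + q * c = l * n" "n * b + q * d = l * q" "r * a - n * c = l * r"
    "r * b - n * d = - l * n"
    using v0 by auto
  have "x * (a * n + b * r - l * n) = 0" "y * (a * n + b * r - l * n) = 0"
    "x * (a * q - b * n - l * q) = 0" "y * (a * q - b * n - l * q) = 0"
    "x * (c * n + d * r - l * r) = 0" "y * (c * n + d * r - l * r) = 0"
    using v l l2 det by algebra+
  then have GN: "a * n + b * r = l * n" "a * q - b * n = l * q" "c * n + d * r = l * r"
    using v0 by auto
  show ?thesis using NG GN conj det by algebra
qed

text \<open>Conjugation preserves the trace and the determinants are 1, so the discriminants agree;
  commutation makes the trace-free parts proportional. If the discriminant is nonzero, the factor is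
  1 or -1, and -1 gives the inverse. Otherwise the trace-free part is nilpotent and
  \<open>nilpotent_conj\<close> applies.\<close>

lemma commuting_conj:
  fixes p q r s p' q' r' s' a b c d :: int
  assumes det: "p * s - q * r = 1" "p' * s' - q' * r' = 1" "a * d - b * c = 1"
    and ne: "\<not> (q = 0 \<and> r = 0 \<and> p = s)"
    and conj: "p' * a + q' * c = a * p + b * r" "p' * b + q' * d = a * q + b * s"
      "r' * a + s' * c = c * p + d * r" "r' * b + s' * d = c * q + d * s"
    and comm: "q' * r = q * r'" "p' * q + q' * s = p * q' + q * s'" "r' * p + s' * r = r * p' + s * r'"
  shows "p' = p \<and> q' = q \<and> r' = r \<and> s' = s \<or> p' = s \<and> q' = - q \<and> r' = - r \<and> s' = p"
proof -
  have tr: "p' + s' = p + s" using conj det(3) by algebra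
  define n where "n = p - s"
  define n' where "n' = p' - s'"
  have nn: "n * n + (2 * q) * (2 * r) = n' * n' + (2 * q') * (2 * r')"
    unfolding n_def n'_def using tr det(1,2) by algebra
  have par: "n' * q = n * q'" "n' * r = n * r'" unfolding n_def n'_def using comm by algebra+
  have "n' = n \<and> q' = q \<and> r' = r \<or> n' = - n \<and> q' = - q \<and> r' = - r"
  proof (cases "n * n + (2 * q) * (2 * r) = 0")
    case True
    have "n' = n \<and> 2 * q' = 2 * q \<and> 2 * r' = 2 * r"
    proof (rule nilpotent_conj[OF det(3) True])
      show "\<not> (n = 0 \<and> 2 * q = 0 \<and> 2 * r = 0)" using ne by (auto simp: n_def)
      show "n' * a + 2 * q' * c = a * n + b * (2 * r)" "n' * b + 2 * q' * d = a * (2 * q) - b * n"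
        "2 * r' * a - n' * c = c * n + d * (2 * r)" "2 * r' * b - n' * d = c * (2 * q) - d * n"
        unfolding n_def n'_def using conj tr by algebra+
    qed (use par comm(1) in \<open>auto simp: algebra_simps\<close>)
    then show ?thesis by simp
  next
    case False
    have "n * n * (n' * n' + (2 * q') * (2 * r')) = n' * n' * (n * n + (2 * q) * (2 * r))"
      "q * q * (n' * n' + (2 * q') * (2 * r')) = q' * q' * (n * n + (2 * q) * (2 * r))"
      "r * r * (n' * n' + (2 * q') * (2 * r')) = r' * r' * (n * n + (2 * q) * (2 * r))"
      using par comm(1) by algebra+
    then have sq: "n * n = n' * n'" "q * q = q' * q'" "r * r = r' * r'"
      using False nn by auto
    then have "n' = n \<or> n' = - n" "q' = q \<or> q' = - q" "r' = r \<or> r' = - r"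
      by (metis square_eq_iff)+
    then show ?thesis using par comm(1) by auto
  qed
  then show ?thesis using tr by (auto simp: n_def n'_def)
qed

lemma free_pair_commuting_conj:
  fixes f g :: "'a \<Rightarrow> 'a"
  assumes free: "free_pair f g" and ne: "ev f g u \<noteq> id"
    and comm: "ev f g u \<circ> ev f g (c @ u @ winv c) = ev f g (c @ u @ winv c) \<circ> ev f g u"
  shows "ev f g (c @ u @ winv c) = ev f g u \<or> ev f g (c @ u @ winv c) = inv (ev f g u)"
proof -
  define E where "E = ev sanov_a sanov_b"
  define v where "v = c @ u @ winv c"
  have b: "bij f" "bij g" using free by (auto simp: free_pair_def)
  have sb: "bij sanov_a" "bij sanov_b" by (auto simp: bij_lin)
  have bu: "bij (ev f g u)" "bij (ev f g v)" by (simp_all add: bij_ev b)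
  have bE: "bij (E w)" for w by (simp add: bij_ev sb E_def)
  \<comment> \<open>Equality of two words is triviality of a single word, to which
    \<open>free_pair_transfer\<close> applies.\<close>
  have transfer: "ev f g x = ev f g y \<longleftrightarrow> E x = E y" for x y
  proof -
    have 1: "h = k \<longleftrightarrow> h \<circ> inv k = id" if "bij k" for h k :: "'b \<Rightarrow> 'b"
    proof
      assume "h \<circ> inv k = id"
      then have "h \<circ> (inv k \<circ> k) = k" by (simp add: o_assoc)
      then show "h = k" using bij_is_inj[OF that] by simp
    qed (use bij_is_surj[OF that] surj_iff in auto)
    have "ev f g x = ev f g y \<longleftrightarrow> ev f g (x @ winv y) = id"
      unfolding ev_append ev_winv[OF b] by (rule 1) (simp add: bij_ev b)
    also have "\<dots> \<longleftrightarrow> E (x @ winv y) = id"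
      unfolding E_def by (rule free_pair_transfer[OF free free_pair_sanov])
    also have "\<dots> \<longleftrightarrow> E x = E y"
      unfolding E_def ev_append ev_winv[OF sb] by (rule 1[symmetric]) (simp add: bij_ev sb)
    finally show ?thesis .
  qed
  have Ene: "E u \<noteq> id" using ne transfer[of u "[]"] by (simp add: E_def)
  obtain p q r s where u: "E u = lin p q r s" "p * s - q * r = 1"
    using ev_sanov_lin[of u] by (auto simp: E_def)
  obtain p' q' r' s' where v: "E v = lin p' q' r' s'" "p' * s' - q' * r' = 1"
    using ev_sanov_lin[of v] by (auto simp: E_def)
  obtain a b' c' d where c: "E c = lin a b' c' d" "a * d - b' * c' = 1"
    using ev_sanov_lin[of c] by (auto simp: E_def)
  have ns: "\<not> (q = 0 \<and> r = 0 \<and> p = s)"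
    using sanov_not_scalar[of u p] Ene u(1) by (auto simp: E_def)
  have "E v = E c \<circ> (E u \<circ> inv (E c))"
    by (simp only: v_def E_def ev_append ev_winv[OF sb])
  then have "E v \<circ> E c = E c \<circ> (E u \<circ> (inv (E c) \<circ> E c))" by (simp only: comp_assoc)
  then have "E v \<circ> E c = E c \<circ> E u" by (simp only: inv_o_cancel[OF bij_is_inj[OF bE]] comp_id)
  then have vc: "p' * a + q' * c' = a * p + b' * r" "p' * b' + q' * d = a * q + b' * s"
      "r' * a + s' * c' = c' * p + d * r" "r' * b' + s' * d = c' * q + d * s"
    unfolding u(1) v(1) c(1) lin_comp lin_eq_iff by auto
  have "ev f g (u @ v) = ev f g (v @ u)" using comm by (simp only: ev_append v_def)
  then have "E u \<circ> E v = E v \<circ> E u"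
    unfolding transfer by (simp only: E_def ev_append)
  then have uv: "p * p' + q * r' = p' * p + q' * r" "p * q' + q * s' = p' * q + q' * s"
      "r * p' + s * r' = r' * p + s' * r"
    unfolding u(1) v(1) lin_comp lin_eq_iff by auto
  have "p' = p \<and> q' = q \<and> r' = r \<and> s' = s \<or> p' = s \<and> q' = - q \<and> r' = - r \<and> s' = p"
    by (rule commuting_conj[OF u(2) v(2) c(2) ns vc]) (use uv in \<open>simp_all add: mult.commute\<close>)
  moreover have "E (winv u) = lin s (- q) (- r) p"
    using inv_lin[OF u(2)] ev_winv[OF sb, of u] u(1) by (simp add: E_def)
  ultimately have "E v = E u \<or> E v = E (winv u)"
    using u(1) v(1) by auto
  then show ?thesis
    using transfer[of v u] transfer[of v "winv u"] by (auto simp: v_def ev_winv[OF b])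
qed

section \<open>Pairs of homeomorphisms of the line\<close>

lemma strict_mono_surj_isCont:
  fixes C :: "real \<Rightarrow> real"
  assumes "strict_mono C" "surj C"
  shows "isCont C x"
  unfolding isCont_def
proof (rule order_tendstoI)
  fix a assume "a < C x"
  moreover obtain y where y: "a = C y" using assms(2) by (auto simp: surj_def)
  ultimately have "y < x" using assms(1) by (simp add: strict_mono_less)
  then have "\<forall>\<^sub>F z in at x. y < z" by (intro order_tendstoD(1)[OF tendsto_ident_at])
  then show "\<forall>\<^sub>F z in at x. a < C z" by eventually_elim (use assms(1) y in \<open>simp add: strict_mono_less\<close>)
next
  fix a assume "C x < a"
  moreover obtain y where y: "a = C y" using assms(2) by (auto simp: surj_def)
  ultimately have "x < y" using assms(1) by (simp add: strict_mono_less)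
  then have "\<forall>\<^sub>F z in at x. z < y" by (intro order_tendstoD(2)[OF tendsto_ident_at])
  then show "\<forall>\<^sub>F z in at x. C z < a" by eventually_elim (use assms(1) y in \<open>simp add: strict_mono_less\<close>)
qed

text \<open>Filters encode one-sided germs: a property holds near an end if it holds
  eventually.\<close>

definition ends :: "real set \<Rightarrow> real filter set" where
  "ends P = insert at_top (insert at_bot (at_left ` P \<union> at_right ` P))"

text \<open>An increasing bijection keeps each infinity and each side of a fixed point, so germ
  identities may be used at image points.\<close>

lemma filterlim_ends:
  fixes C :: "real \<Rightarrow> real"
  assumes C: "strict_mono C" "surj C" and fixed: "\<And>p. p \<in> P \<Longrightarrow> C p = p" and F: "F \<in> ends P"
  shows "filterlim C F F"
proof -
  have top: "filterlim C at_top at_top"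
    unfolding filterlim_at_top eventually_at_top_linorder
  proof
    fix Z obtain z where "Z = C z" using C(2) by (auto simp: surj_def)
    then show "\<exists>N. \<forall>n\<ge>N. Z \<le> C n" using C(1) by (auto simp: strict_mono_less_eq)
  qed
  have bot: "filterlim C at_bot at_bot"
    unfolding filterlim_at_bot eventually_at_bot_linorder
  proof
    fix Z obtain z where "Z = C z" using C(2) by (auto simp: surj_def)
    then show "\<exists>N. \<forall>n\<le>N. C n \<le> Z" using C(1) by (auto simp: strict_mono_less_eq)
  qed
  have p: "filterlim C (at_left p) (at_left p)" "filterlim C (at_right p) (at_right p)" if "p \<in> P" for p
  proof -
    have c: "(C \<longlongrightarrow> p) (at p)"
      using strict_mono_surj_isCont[OF C, of p] fixed[OF that] by (simp add: isCont_def)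
    have "C x < p \<longleftrightarrow> x < p" "p < C x \<longleftrightarrow> p < x" for x
      using strict_mono_less[OF C(1), of x p] strict_mono_less[OF C(1), of p x] fixed[OF that] by auto
    then have "\<forall>\<^sub>F x in at_left p. C x \<in> {..<p} \<and> C x \<noteq> p"
      "\<forall>\<^sub>F x in at_right p. C x \<in> {p<..} \<and> C x \<noteq> p"
      unfolding eventually_at_filter by (auto simp: order_less_imp_not_eq intro!: always_eventually)
    moreover have "(C \<longlongrightarrow> p) (at_left p)" "(C \<longlongrightarrow> p) (at_right p)"
      by (auto intro: filterlim_mono[OF c order_refl] at_le)
    ultimately show "filterlim C (at_left p) (at_left p)" "filterlim C (at_right p) (at_right p)"
      unfolding filterlim_at by simp_all
  qed
  show ?thesis using F top bot p by (auto simp: ends_def)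
qed

section \<open>Common fixed points, germs and orbits of two increasing homeomorphisms\<close>

locale two_homeos =
  fixes F G :: "real \<Rightarrow> real"
  assumes mono_F: "strict_mono F" and surj_F: "surj F"
    and mono_G: "strict_mono G" and surj_G: "surj G"
begin

abbreviation W :: "(bool \<times> bool) list \<Rightarrow> real \<Rightarrow> real" where
  "W \<equiv> ev F G"

definition Fix :: "real set" where
  "Fix = {x. F x = x \<and> G x = x}"

definition germ_trivial :: "(bool \<times> bool) list \<Rightarrow> bool" where
  "germ_trivial u \<longleftrightarrow> (\<forall>E\<in>ends Fix. \<forall>\<^sub>F x in E. W u x = x)"

lemma bij_FG: "bij F" "bij G"
  using mono_F surj_F mono_G surj_G by (auto simp: bij_def strict_mono_imp_inj_on)

lemma strict_mono_inv_surj: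
  fixes C :: "real \<Rightarrow> real"
  assumes "strict_mono C" "surj C"
  shows "strict_mono (inv C)"
  unfolding strict_mono_def
proof (intro allI impI)
  fix x y :: real assume "x < y"
  then have "C (inv C x) < C (inv C y)" by (simp add: surj_f_inv_f assms(2))
  then show "inv C x < inv C y" by (simp add: strict_mono_less assms(1))
qed

lemma strict_mono_W: "strict_mono (W w)"
  by (induction w)
    (auto simp: ev_Cons strict_mono_o mono_F mono_G strict_mono_inv_surj surj_F surj_G strict_mono_def[of "\<lambda>x. x"])

lemma bij_W: "bij (W w)"
  by (simp add: bij_ev bij_FG)

lemma W_less_iff: "W w x < W w y \<longleftrightarrow> x < y"
  by (simp add: strict_mono_W strict_mono_less)

lemma W_eq_iff: "W w x = W w y \<longleftrightarrow> x = y"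
  by (simp add: strict_mono_W strict_mono_eq)

lemma W_append: "W (u @ v) x = W u (W v x)"
  by (simp add: ev_append)

lemma W_winv [simp]: "W (winv w) (W w x) = x" "W w (W (winv w) x) = x"
  using bij_W[of w] by (simp_all add: ev_winv bij_FG bij_is_inj bij_is_surj surj_f_inv_f)

lemma W_Fix: "x \<in> Fix \<Longrightarrow> W w x = x"
proof (induction w)
  case (Cons l w)
  obtain i e where "l = (i, e)" by force
  with Cons show ?case
    by (auto simp: ev_Cons Fix_def inv_f_eq bij_is_inj bij_FG)
qed simp

lemma closed_Fix: "closed Fix"
proof -
  have "continuous_on UNIV F" "continuous_on UNIV G"
    using strict_mono_surj_isCont mono_F surj_F mono_G surj_G
    by (auto simp: continuous_on_eq_continuous_at)
  then show ?thesis unfolding Fix_def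
    by (intro closed_Collect_conj closed_Collect_eq continuous_on_id)
qed

lemma filterlim_W: "E \<in> ends Fix \<Longrightarrow> filterlim (W w) E E"
  by (rule filterlim_ends[where P = Fix]) (auto simp: strict_mono_W bij_W bij_is_surj W_Fix)

lemma germ_trivial_append: "germ_trivial u \<Longrightarrow> germ_trivial v \<Longrightarrow> germ_trivial (u @ v)"
  unfolding germ_trivial_def W_append by (auto elim!: eventually_elim2)

lemma germ_trivial_winv: "germ_trivial u \<Longrightarrow> germ_trivial (winv u)"
  unfolding germ_trivial_def
proof
  fix E assume "\<forall>E\<in>ends Fix. \<forall>\<^sub>F x in E. W u x = x" "E \<in> ends Fix"
  then have "\<forall>\<^sub>F x in E. W u x = x" by blast
  then show "\<forall>\<^sub>F x in E. W (winv u) x = x"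
  proof eventually_elim
    case (elim x)
    then show ?case using W_winv(1)[of u x] by simp
  qed
qed

text \<open>By \<open>filterlim_W\<close>, points near an end are sent by \<open>winv c\<close> to
  points near the same end, where \<open>u\<close> is trivial.\<close>

lemma germ_trivial_conj:
  assumes "germ_trivial u"
  shows "germ_trivial (c @ u @ winv c)"
  unfolding germ_trivial_def
proof
  fix E assume E: "E \<in> ends Fix"
  have "\<forall>\<^sub>F x in E. W u (W (winv c) x) = W (winv c) x"
    using filterlim_W[OF E] assms E unfolding germ_trivial_def filterlim_iff by blast
  then show "\<forall>\<^sub>F x in E. W (c @ u @ winv c) x = x"
    by eventually_elim (simp add: W_append)
qed

text \<open>Otherwise the orbit of \<open>m\<close> is bounded and its supremum is a common fixed
  point in \<open>{m..M}\<close>.\<close>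

lemma orbit_escapes:
  assumes disj: "{m..M} \<inter> Fix = {}" and "m \<le> M"
  shows "\<exists>c. M < W c m"
proof (rule ccontr)
  assume "\<not> ?thesis"
  then have le: "W c m \<le> M" for c by (auto simp: not_less)
  define s where "s = (SUP c. W c m)"
  have bdd: "bdd_above (range (\<lambda>c. W c m))" by (rule bdd_aboveI[of _ M]) (auto simp: le)
  have up: "W c m \<le> s" for c unfolding s_def by (intro cSUP_upper bdd) auto
  have "s \<le> M" unfolding s_def by (intro cSUP_least) (auto simp: le)
  moreover have "m \<le> s" using up[of "[]"] by simp
  ultimately have "s \<notin> Fix" using disj by auto
  have "W [l] s \<le> s" for l
  proof (rule ccontr)
    assume "\<not> W [l] s \<le> s"
    \<comment> \<open>The inverse of a letter raising \<open>s\<close> sends \<open>s\<close> below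
      some orbit point; applying the letter to that point exceeds the supremum.\<close>
    then have "W (winv [l]) s < s" using W_less_iff[of "winv [l]" s "W [l] s"] by simp
    then obtain c where "W (winv [l]) s < W c m"
      unfolding s_def using bdd less_cSUP_iff[of UNIV "\<lambda>c. W c m"] by auto
    then have "s < W ([l] @ c) m"
      using W_less_iff[of "[l]" "W (winv [l]) s" "W c m"] W_append[of "[l]" c m] by simp
    then show False using up[of "[l] @ c"] by simp
  qed
  note this[of "(True, True)"] this[of "(True, False)"] this[of "(False, True)"] this[of "(False, False)"]
  then have "F s \<le> s" "inv F s \<le> s" "G s \<le> s" "inv G s \<le> s" by (simp_all add: ev_Cons)
  moreover have "s \<le> F s" "s \<le> G s"
    using strict_mono_less_eq[OF mono_F, of "inv F s" s] strict_mono_less_eq[OF mono_G, of "inv G s" s]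
      calculation surj_F surj_G by (simp_all add: surj_f_inv_f)
  ultimately show False using \<open>s \<notin> Fix\<close> by (auto simp: Fix_def)
qed

text \<open>The set \<open>D\<close> is a half-line up to the next common fixed point (or the whole line), so it is
  invariant. Moving the support of \<open>u\<close> in \<open>D\<close> off itself by a conjugation gives an element that
  commutes with \<open>u\<close> on \<open>D\<close>; the commutator survives because the group is free.\<close>
lemma commutator_trivial_on_invariant_set:
  assumes free: "free_pair F G" and u: "germ_trivial u"
    and D: "\<And>w x. x \<in> D \<Longrightarrow> W w x \<in> D"
    and supp: "\<And>x. x \<in> D \<Longrightarrow> W u x \<noteq> x \<Longrightarrow> x \<in> {m..M}"
    and disj: "{m..M} \<inter> Fix = {}"
    and moved: "x0 \<in> D" "W u x0 \<noteq> x0"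
  shows "\<exists>u'. germ_trivial u' \<and> W u' \<noteq> id \<and> (\<forall>x\<in>D. W u' x = x)"
proof -
  have "m \<le> M" using supp[OF moved] by simp
  then obtain c where c: "M < W c m" using orbit_escapes disj by blast
  define v where "v = c @ u @ winv c"
  \<comment> \<open>Within \<open>D\<close>, the support of \<open>v\<close> is the image under
    \<open>c\<close> of that of \<open>u\<close>, so it starts no earlier than \<open>W c m\<close>,
    which exceeds \<open>M\<close>.\<close>
  have v: "M < x" if "x \<in> D" "W v x \<noteq> x" for x
  proof -
    have "W u (W (winv c) x) \<noteq> W (winv c) x"
      using that(2) by (auto simp: v_def W_append)
    then have "m \<le> W (winv c) x" using supp D[OF that(1)] by auto
    then have "W c m \<le> x" using W_less_iff[of c "W (winv c) x" m] by (simp add: not_less[symmetric])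
    with c show ?thesis by simp
  qed
  \<comment> \<open>The supports of \<open>u\<close> and \<open>v\<close> in \<open>D\<close> are
    disjoint, and each map preserves its own support.\<close>
  have comm: "W u (W v x) = W v (W u x)" if x: "x \<in> D" for x
  proof (cases "W u x = x")
    case False
    then have "W u (W u x) \<noteq> W u x" by (simp add: W_eq_iff)
    then have "x \<le> M" "W u x \<le> M" using False supp[OF x] supp[OF D[OF x]] by auto
    then have "W v x = x" "W v (W u x) = W u x"
      using v[OF x] v[OF D[OF x], of u] by (meson not_less)+
    then show ?thesis by simp
  next
    case True
    show ?thesis
    proof (cases "W v x = x")
      case False
      then have "W v (W v x) \<noteq> W v x" by (simp add: W_eq_iff)
      then have "M < W v x" by (rule v[OF D[OF x]])
      then have "W u (W v x) = W v x" using supp[OF D[OF x], of v] by force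
      then show ?thesis by (simp add: True)
    qed (simp add: True)
  qed
  define u' where "u' = (u @ v) @ winv (v @ u)"
  have "germ_trivial u'" unfolding u'_def v_def
    by (intro germ_trivial_append germ_trivial_winv germ_trivial_conj u)
  moreover have "W u' x = x" if "x \<in> D" for x
  proof -
    define y where "y = W (winv (v @ u)) x"
    have "y \<in> D" unfolding y_def by (rule D[OF that])
    then have "W (u @ v) y = W (v @ u) y" using comm by (simp add: W_append)
    then show ?thesis unfolding u'_def W_append[of "u @ v"] y_def[symmetric] by (simp add: y_def)
  qed
  moreover have "W u' \<noteq> id"
  proof
    assume id: "W u' = id"
    have "W u (W v x) = W v (W u x)" for x
    proof -
      have "W (u @ v) (W (winv (v @ u)) (W (v @ u) x)) = W (v @ u) x"
        using fun_cong[OF id, of "W (v @ u) x"] unfolding u'_def W_append[of "u @ v"] by simp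
      then show ?thesis unfolding W_winv by (simp only: W_append)
    qed
    then have "W u \<circ> W v = W v \<circ> W u" by auto
    moreover have "W u \<noteq> id" using moved by auto
    ultimately have "W v = W u \<or> W v = inv (W u)"
      unfolding v_def using free_pair_commuting_conj[OF free] by blast
    \<comment> \<open>Both \<open>u\<close> and its inverse move \<open>x0\<close>, which is at most
      \<open>M\<close>, whereas within \<open>D\<close> only points beyond \<open>M\<close> are
      moved by \<open>v\<close>.\<close>
    then have "W v x0 \<noteq> x0" using moved(2) bij_inv_eq_iff[OF bij_W[of u], of x0 x0] by auto
    then show False using v[OF moved(1)] supp[OF moved] by simp
  qed
  ultimately show ?thesis by blast
qed

text \<open>These are the right endpoints of the gaps of \<open>Fix\<close>; they label the gaps
  that the descent clears.\<close>

definition left_isolated :: "real set" where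
  "left_isolated = {b \<in> Fix. \<exists>e<b. {e<..<b} \<inter> Fix = {}}"

text \<open>Induction on the number of \<open>left_isolated\<close> points with a moved point to
  their left. The commutator built for the leftmost moved gap removes the right endpoint of that gap
  from this set and adds no other point.\<close>

lemma germ_trivial_free_False:
  assumes free: "free_pair F G" and fin: "finite left_isolated"
    and "germ_trivial u" "W u \<noteq> id"
  shows False
  using assms(3,4)
proof (induction "card {b \<in> left_isolated. \<exists>x<b. W u x \<noteq> x}" arbitrary: u rule: less_induct)
  case less
  define S where "S = {x. W u x \<noteq> x}"
  have "S \<noteq> {}" using less.prems(2) by (auto simp: S_def)
  have germ: "\<forall>\<^sub>F x in E. x \<notin> S" if "E \<in> ends Fix" for E
    using less.prems(1) that by (simp add: germ_trivial_def S_def)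
  obtain R0 where R0: "x \<notin> S" if "x \<le> R0" for x
    using germ[of at_bot] by (auto simp: ends_def eventually_at_bot_linorder)
  have "R0 \<le> x" if "x \<in> S" for x using R0[of x] that by linarith
  then have bdd: "bdd_below S" by (rule bdd_belowI)
  define m where "m = Inf S"
  have m: "m \<le> x" if "x \<in> S" for x unfolding m_def using that bdd by (rule cInf_lower)
  have m': "\<exists>x\<in>S. x < y" if "m < y" for y
    using that cInf_less_iff[OF \<open>S \<noteq> {}\<close> bdd] by (auto simp: m_def)
  \<comment> \<open>A common fixed point has trivial germ on its right, yet the support would
    accumulate there.\<close>
  have "m \<notin> Fix"
  proof
    assume "m \<in> Fix"
    then have "m \<notin> S" by (simp add: S_def W_Fix)
    from \<open>m \<in> Fix\<close> germ[of "at_right m"] obtain y where "m < y" "\<And>x. m < x \<Longrightarrow> x < y \<Longrightarrow> x \<notin> S"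
      by (auto simp: ends_def eventually_at_right_field)
    then show False using m'[of y] m \<open>m \<notin> S\<close> by (auto simp: order_le_less)
  qed
  show False
  proof (cases "Fix \<inter> {m<..} = {}")
    case True
    obtain R where R: "x \<notin> S" if "R \<le> x" for x
      using germ[of at_top] by (auto simp: ends_def eventually_at_top_linorder)
    obtain x0 where "x0 \<in> S" using \<open>S \<noteq> {}\<close> by blast
    \<comment> \<open>No common fixed point lies right of \<open>m\<close>, so the whole support is
      in one gap; with \<open>D = UNIV\<close> the new commutator is both nontrivial and
      trivial.\<close>
    have "\<exists>u'. germ_trivial u' \<and> W u' \<noteq> id \<and> (\<forall>x\<in>UNIV. W u' x = x)"
    proof (rule commutator_trivial_on_invariant_set[OF free less.prems(1)])
      show "x \<in> {m..R}" if "W u x \<noteq> x" for x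
        using m[of x] R[of x] that by (force simp: S_def)
      show "{m..R} \<inter> Fix = {}" using True \<open>m \<notin> Fix\<close> by (auto simp: order_le_less)
      show "W u x0 \<noteq> x0" using \<open>x0 \<in> S\<close> by (simp add: S_def)
    qed auto
    then show False by auto
  next
    case False
    define b where "b = Inf (Fix \<inter> {m<..})"
    have bddF: "bdd_below (Fix \<inter> {m<..})" by (intro bdd_belowI[of _ m]) auto
    have "Fix \<inter> {m<..} = Fix \<inter> {m..}" using \<open>m \<notin> Fix\<close> by (auto simp: order_le_less)
    then have "closed (Fix \<inter> {m<..})" using closed_Fix by (simp add: closed_Int)
    from closed_contains_Inf[OF False bddF this]
    have b: "b \<in> Fix" "m < b" by (auto simp: b_def)
    have gap: "x \<notin> Fix" if "m < x" "x < b" for x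
      using that cInf_lower[OF _ bddF, of x] by (auto simp: b_def)
    have bl: "b \<in> left_isolated" using b gap by (auto simp: left_isolated_def)
    obtain M where M: "M < b" "\<And>x. M < x \<Longrightarrow> x < b \<Longrightarrow> x \<notin> S"
      using b germ[of "at_left b"] by (auto simp: ends_def eventually_at_left_field)
    obtain x0 where x0: "x0 \<in> S" "x0 < b" using m' b by blast
    have "\<exists>u'. germ_trivial u' \<and> W u' \<noteq> id \<and> (\<forall>x\<in>{..<b}. W u' x = x)"
    proof (rule commutator_trivial_on_invariant_set[OF free less.prems(1)])
      show "W w x \<in> {..<b}" if "x \<in> {..<b}" for w x
        using that W_less_iff[of w x b] W_Fix[OF b(1)] by simp
      show "x \<in> {m..M}" if "x \<in> {..<b}" "W u x \<noteq> x" for x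
        using m[of x] M(2)[of x] that by (force simp: S_def)
      show "{m..M} \<inter> Fix = {}" using gap M(1) \<open>m \<notin> Fix\<close> by (force simp: order_le_less)
      show "W u x0 \<noteq> x0" "x0 \<in> {..<b}" using x0 by (simp_all add: S_def)
    qed
    then obtain u' where u': "germ_trivial u'" "W u' \<noteq> id" "\<And>x. x < b \<Longrightarrow> W u' x = x" by auto
    \<comment> \<open>\<open>b\<close> drops out since \<open>u'\<close> is trivial left of it.
      Points counted for \<open>u'\<close> lie right of \<open>b\<close>, so \<open>x0\<close> shows
      that they were counted for \<open>u\<close>.\<close>
    have "{b' \<in> left_isolated. \<exists>x<b'. W u' x \<noteq> x} \<subset> {b \<in> left_isolated. \<exists>x<b. W u x \<noteq> x}"
    proof (rule psubsetI)
      show "{b' \<in> left_isolated. \<exists>x<b'. W u' x \<noteq> x} \<subseteq> {b \<in> left_isolated. \<exists>x<b. W u x \<noteq> x}"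
      proof safe
        fix b' x assume "x < b'" "W u' x \<noteq> x"
        moreover from this have "b \<le> x" using u'(3)[of x] by linarith
        ultimately show "\<exists>x<b'. W u x \<noteq> x" using x0 by (intro exI[of _ x0]) (auto simp: S_def)
      qed
      have "b \<in> {b \<in> left_isolated. \<exists>x<b. W u x \<noteq> x}" using bl x0 by (auto simp: S_def)
      then show "{b' \<in> left_isolated. \<exists>x<b'. W u' x \<noteq> x} \<noteq> {b \<in> left_isolated. \<exists>x<b. W u x \<noteq> x}"
        using u'(3) by blast
    qed
    then have "card {b' \<in> left_isolated. \<exists>x<b'. W u' x \<noteq> x} < card {b \<in> left_isolated. \<exists>x<b. W u x \<noteq> x}"
      by (intro psubset_card_mono) (simp_all add: fin)
    then show False using less.hyps u'(1,2) by blast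
  qed
qed

end

section \<open>Piecewise projective maps of the line\<close>

definition aff_germ :: "real filter \<Rightarrow> (real \<Rightarrow> real) \<Rightarrow> (real \<Rightarrow> real) \<Rightarrow> bool" where
  "aff_germ E \<phi> C \<longleftrightarrow> (\<exists>l k. l \<noteq> 0 \<and> (\<forall>\<^sub>F x in E. \<phi> (C x) = l * \<phi> x + k))"

text \<open>The reduced form of \<open>[[a, b], [a^-1, b]]\<close>, an element of the second derived subgroup.\<close>
definition double_commutator :: "(bool \<times> bool) list" where
  "double_commutator =
    (let a = (True, True); a' = (True, False); b = (False, True); b' = (False, False)
     in [a, b, a', b', a', b, a, a, b', a', b, a', b', a])"

lemma reduced_double_commutator: "reduced double_commutator" "double_commutator \<noteq> []"
  by (simp_all add: double_commutator_def Let_def)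

lemma inv_affine:
  fixes l k :: real
  assumes "l \<noteq> 0"
  shows "inv (\<lambda>x. l * x + k) = (\<lambda>x. (x - k) / l)"
  by (rule inv_unique_comp) (use assms in \<open>auto simp: fun_eq_iff field_simps\<close>)

text \<open>The affine group is metabelian: commutators of affine maps are translations, which
  commute.\<close>

lemma ev_affine_double_commutator:
  fixes l k m n :: real
  assumes "l \<noteq> 0" "m \<noteq> 0"
  shows "ev (\<lambda>x. l * x + k) (\<lambda>x. m * x + n) double_commutator = id"
proof
  fix x
  show "ev (\<lambda>x. l * x + k) (\<lambda>x. m * x + n) double_commutator x = id x"
    using assms by (simp add: double_commutator_def Let_def ev_Cons inv_affine) (simp add: field_simps)
qed

section \<open>Words near an end, read in an affine chart\<close>

context two_homeos
begin

lemma ev_chart: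
  fixes \<phi> :: "real \<Rightarrow> real" and l k m n :: real
  assumes E: "E \<in> ends Fix" and l: "l \<noteq> 0" "m \<noteq> 0"
    and F: "\<forall>\<^sub>F x in E. \<phi> (F x) = l * \<phi> x + k"
    and G: "\<forall>\<^sub>F x in E. \<phi> (G x) = m * \<phi> x + n"
  shows "\<forall>\<^sub>F x in E. \<phi> (W w x) = ev (\<lambda>x. l * x + k) (\<lambda>x. m * x + n) w (\<phi> x)"
proof (induction w)
  case (Cons a w)
  obtain i e where a: "a = (i, e)" by force
  have lim: "filterlim (W (a # w)) E E" "filterlim (W w) E E" by (simp_all add: filterlim_W E)
  define C where "C = (if i then F else G)"
  define r where "r = (if i then l else m)"
  define s where "s = (if i then k else n)"
  have C: "\<forall>\<^sub>F x in E. \<phi> (C x) = r * \<phi> x + s" using F G by (simp add: C_def r_def s_def)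
  have r: "r \<noteq> 0" using l by (simp add: r_def)
  have surj: "surj C" using surj_F surj_G by (simp add: C_def)
  have rhs: "ev (\<lambda>x. l * x + k) (\<lambda>x. m * x + n) (a # w) y =
     (if e then r * ev (\<lambda>x. l * x + k) (\<lambda>x. m * x + n) w y + s
      else (ev (\<lambda>x. l * x + k) (\<lambda>x. m * x + n) w y - s) / r)" for y
    using l by (simp add: a ev_Cons inv_affine r_def s_def)
  show ?case
  proof (cases e)
    case True
    have "\<forall>\<^sub>F x in E. \<phi> (C (W w x)) = r * \<phi> (W w x) + s"
      using lim(2) C unfolding filterlim_iff by blast
    with Cons show ?thesis
      by eventually_elim (simp add: rhs True, simp add: a ev_Cons True C_def)
  next
    case False
    \<comment> \<open>For an inverse letter, the germ identity of \<open>C\<close> is used at the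
      new point and solved for its chart value.\<close>
    have "W (a # w) x = inv C (W w x)" for x by (simp add: a ev_Cons False C_def)
    then have CW: "C (W (a # w) x) = W w x" for x by (simp add: surj surj_f_inv_f)
    have "\<forall>\<^sub>F x in E. \<phi> (C (W (a # w) x)) = r * \<phi> (W (a # w) x) + s"
      using lim(1) C unfolding filterlim_iff by blast
    with Cons show ?thesis
    proof eventually_elim
      case (elim x)
      then have "ev (\<lambda>x. l * x + k) (\<lambda>x. m * x + n) w (\<phi> x) - s = r * \<phi> (W (a # w) x)"
        by (simp add: CW)
      then show ?case unfolding rhs using r False by simp
    qed
  qed
qed simp

lemma germ_trivial_double_commutator:
  assumes "\<And>E. E \<in> ends Fix \<Longrightarrow> \<exists>\<phi>. inj \<phi> \<and> aff_germ E \<phi> F \<and> aff_germ E \<phi> G"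
  shows "germ_trivial double_commutator"
  unfolding germ_trivial_def
proof
  fix E assume E: "E \<in> ends Fix"
  obtain \<phi> where \<phi>: "inj \<phi>" "aff_germ E \<phi> F" "aff_germ E \<phi> G" using assms[OF E] by blast
  from \<phi>(2,3) obtain l k m n where lm: "l \<noteq> 0" "m \<noteq> 0"
    "\<forall>\<^sub>F x in E. \<phi> (F x) = l * \<phi> x + k" "\<forall>\<^sub>F x in E. \<phi> (G x) = m * \<phi> x + n"
    unfolding aff_germ_def by blast
  from ev_chart[where \<phi> = \<phi>, OF E lm, of double_commutator]
  show "\<forall>\<^sub>F x in E. W double_commutator x = x"
    by eventually_elim (simp add: ev_affine_double_commutator lm(1,2) inj_eq[OF \<phi>(1)])
qed

end

section \<open>Local form and monotonicity of piecewise projective maps\<close>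

definition mob_on :: "real set \<Rightarrow> (real \<Rightarrow> real) \<Rightarrow> real \<Rightarrow> real \<Rightarrow> real \<Rightarrow> real \<Rightarrow> bool" where
  "mob_on X C a b c d \<longleftrightarrow> a * d - b * c = 1 \<and>
     (\<forall>x\<in>X. c * x + d \<noteq> 0 \<and> C x = (a * x + b) / (c * x + d))"

definition pw_mob :: "(real \<Rightarrow> real) \<Rightarrow> bool" where
  "pw_mob C \<longleftrightarrow> (\<exists>\<X>. finite \<X> \<and> \<Union>\<X> = UNIV \<and>
     (\<forall>X\<in>\<X>. is_interval X \<and> (\<exists>a b c d. mob_on X C a b c d)))"

text \<open>By convexity, an interval that meets every neighbourhood of an end contains one of
  them.\<close>

lemma interval_at_end:
  assumes X: "is_interval X" and E: "E \<in> ends UNIV"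
  shows "(\<forall>\<^sub>F x in E. x \<in> X) \<or> (\<forall>\<^sub>F x in E. x \<notin> X)"
proof -
  have mem: "z \<in> X" if "x \<in> X" "y \<in> X" "x \<le> z" "z \<le> y" for x y z
    using X that unfolding is_interval_1 by blast
  have top: ?thesis if "E = at_top"
  proof (rule disjCI)
    assume "\<not> (\<forall>\<^sub>F x in E. x \<notin> X)"
    then have un: "\<exists>y\<ge>x. y \<in> X" for x by (auto simp: that eventually_at_top_linorder)
    then obtain y where "y \<in> X" by blast
    then have "x \<in> X" if "y \<le> x" for x using un[of x] mem that by blast
    then show "\<forall>\<^sub>F x in E. x \<in> X" unfolding that eventually_at_top_linorder by blast
  qed
  have bot: ?thesis if "E = at_bot"
  proof (rule disjCI)
    assume "\<not> (\<forall>\<^sub>F x in E. x \<notin> X)"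
    then have un: "\<exists>y\<le>x. y \<in> X" for x by (auto simp: that eventually_at_bot_linorder)
    then obtain y where "y \<in> X" by blast
    then have "x \<in> X" if "x \<le> y" for x using un[of x] mem that by blast
    then show "\<forall>\<^sub>F x in E. x \<in> X" unfolding that eventually_at_bot_linorder by blast
  qed
  have left: ?thesis if "E = at_left p" for p
  proof (rule disjCI)
    assume "\<not> (\<forall>\<^sub>F x in E. x \<notin> X)"
    then have un: "\<exists>y>x. y < p \<and> y \<in> X" if "x < p" for x
      using that by (auto simp: \<open>E = at_left p\<close> eventually_at_left_field)
    then obtain y where y: "y \<in> X" "y < p" using lt_ex by blast
    then have "x \<in> X" if "y < x" "x < p" for x
      using un[OF that(2)] mem that(1) by (meson less_imp_le)
    then show "\<forall>\<^sub>F x in E. x \<in> X" unfolding that eventually_at_left_field using y by blast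
  qed
  have right: ?thesis if "E = at_right p" for p
  proof (rule disjCI)
    assume "\<not> (\<forall>\<^sub>F x in E. x \<notin> X)"
    then have un: "\<exists>y<x. p < y \<and> y \<in> X" if "p < x" for x
      using that by (auto simp: \<open>E = at_right p\<close> eventually_at_right_field)
    then obtain y where y: "y \<in> X" "p < y" using gt_ex by blast
    then have "x \<in> X" if "x < y" "p < x" for x
      using un[OF that(2)] mem that(1) by (meson less_imp_le)
    then show "\<forall>\<^sub>F x in E. x \<in> X" unfolding that eventually_at_right_field using y by blast
  qed
  show ?thesis using E top bot left right by (auto simp: ends_def)
qed

text \<open>If each of the finitely many pieces were eventually avoided, so would be the whole
  line.\<close>

lemma pw_mob_at_end:
  assumes "pw_mob C" and E: "E \<in> ends UNIV"
  obtains X a b c d where "is_interval X" "mob_on X C a b c d" "\<forall>\<^sub>F x in E. x \<in> X"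
proof -
  obtain \<X> where \<X>: "finite \<X>" "\<Union>\<X> = UNIV"
    "\<forall>X\<in>\<X>. is_interval X \<and> (\<exists>a b c d. mob_on X C a b c d)"
    using assms(1) unfolding pw_mob_def by (elim exE conjE)
  have "E \<noteq> bot"
    using E unfolding ends_def by (elim insertE UnE imageE) simp_all
  have "\<exists>X\<in>\<X>. \<forall>\<^sub>F x in E. x \<in> X"
  proof (rule ccontr)
    assume "\<not> ?thesis"
    then have "\<forall>X\<in>\<X>. \<forall>\<^sub>F x in E. x \<notin> X" using interval_at_end[OF _ E] \<X>(3) by auto
    then have "\<forall>\<^sub>F x in E. \<forall>X\<in>\<X>. x \<notin> X" using \<X>(1) by (simp add: eventually_ball_finite)
    then have "\<forall>\<^sub>F x in E. False" by eventually_elim (use \<X>(2) in blast)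
    with \<open>E \<noteq> bot\<close> show False by simp
  qed
  then obtain X where X: "X \<in> \<X>" "\<forall>\<^sub>F x in E. x \<in> X" by blast
  then obtain a b c d where C: "mob_on X C a b c d" using \<X>(3) by blast
  have "is_interval X" using \<X>(3) X(1) by simp
  then show ?thesis using C X(2) by (rule that)
qed

text \<open>By determinant 1, the difference of the values is \<open>y - x\<close> over the product
  of the denominators, which is positive because the pole lies outside the interval.\<close>

lemma mob_on_strict_mono_on:
  assumes X: "is_interval X" and C: "mob_on X C a b c d" and xy: "x \<in> X" "y \<in> X" "x < y"
  shows "C x < C y"
proof -
  have nz: "c * z + d \<noteq> 0" if "z \<in> X" for z using C that by (auto simp: mob_on_def)
  have det: "a * d - b * c = 1" using C by (simp add: mob_on_def)
  have "0 < (c * x + d) * (c * y + d)"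
  proof (rule ccontr)
    assume "\<not> ?thesis"
    then have neg: "(c * x + d) * (c * y + d) < 0" using nz xy by (simp add: not_less order_le_less)
    then have "c \<noteq> 0" by (auto simp: mult_less_0_iff)
    define z where "z = - d / c"
    have cz: "c * z + d = 0" using \<open>c \<noteq> 0\<close> by (simp add: z_def)
    have "(c * x + d) * (c * y + d) = c\<^sup>2 * ((x - z) * (y - z))"
      using cz by (simp add: power2_eq_square) algebra
    with neg have "(x - z) * (y - z) < 0" by (simp add: mult_less_0_iff)
    then have "x \<le> z" "z \<le> y" using xy(3) by (auto simp: mult_less_0_iff)
    then have "z \<in> X" using X xy unfolding is_interval_1 by blast
    with nz cz show False by blast
  qed
  moreover have "C y - C x = (y - x) / ((c * x + d) * (c * y + d))"
  proof -
    have "(a * y + b) * (c * x + d) - (a * x + b) * (c * y + d) = y - x"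
      using det by algebra
    then show ?thesis using C xy nz[OF xy(1)] nz[OF xy(2)] by (simp add: mob_on_def diff_frac_eq mult.commute)
  qed
  ultimately show ?thesis using xy(3) by (metis diff_gt_0_iff_gt divide_pos_pos)
qed

text \<open>A continuous injection is monotone, and the piece near \<open>at_top\<close> is
  increasing, which settles the direction.\<close>

lemma pw_mob_strict_mono:
  assumes pw: "pw_mob C" and cont: "continuous_on UNIV C" and inj: "inj C"
  shows "strict_mono C"
proof -
  obtain X a b c d where X: "is_interval X" "mob_on X C a b c d" "\<forall>\<^sub>F x in at_top. x \<in> X"
    by (rule pw_mob_at_end[OF pw, of at_top]) (simp add: ends_def)
  obtain R where R: "\<And>x. R \<le> x \<Longrightarrow> x \<in> X" using X(3) by (auto simp: eventually_at_top_linorder)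
  have betw: "C x < C y \<and> C y < C z \<or> C z < C y \<and> C y < C x" if "x < y" "y < z" for x y z
    using continuous_inj_imp_mono[of x y z C] that continuous_on_subset[OF cont] inj
    by (auto intro: inj_on_subset)
  show ?thesis
  proof (rule strict_monoI)
    fix x y :: real assume "x < y"
    define z where "z = max (y + 1) R"
    have z: "y < z" "C z < C (z + 1)"
      using mob_on_strict_mono_on[OF X(1,2) R R, of z "z + 1"] by (auto simp: z_def)
    show "C x < C y" using betw[of y z "z + 1"] betw[of x y z] z \<open>x < y\<close> by auto
  qed
qed

text \<open>With \<open>c\<close> nonzero the map would tend to \<open>a / c\<close>, while an
  increasing bijection is unbounded at infinity; so the outermost pieces are affine.\<close>

lemma aff_germ_infinity:
  assumes C: "pw_mob C" "strict_mono C" "surj C" and E: "E = at_top \<or> E = at_bot"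
  shows "aff_germ E (\<lambda>x. x) C"
proof -
  have E': "E \<in> ends {}" "E \<in> ends UNIV" using E by (auto simp: ends_def)
  obtain X a b c d where X: "mob_on X C a b c d" "\<forall>\<^sub>F x in E. x \<in> X"
    by (rule pw_mob_at_end[OF C(1) E'(2)])
  have det: "a * d - b * c = 1" using X(1) by (simp add: mob_on_def)
  have CX: "\<forall>\<^sub>F x in E. c * x + d \<noteq> 0 \<and> C x = (a * x + b) / (c * x + d)"
    using X(2) by eventually_elim (use X(1) in \<open>auto simp: mob_on_def\<close>)
  have nb: "E \<noteq> bot" using E by (elim disjE) simp_all
  have inf: "E \<le> at_infinity" using E at_top_le_at_infinity at_bot_le_at_infinity by auto
  have "c = 0"
  proof (rule ccontr)
    assume c: "c \<noteq> 0"
    have "filterlim (\<lambda>x. x) at_infinity E"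
      by (rule filterlim_mono[OF filterlim_ident inf order_refl])
    then have "filterlim (\<lambda>x. d + c * x) at_infinity E"
      using c by (intro tendsto_add_filterlim_at_infinity[OF tendsto_const]
          tendsto_mult_filterlim_at_infinity[OF tendsto_const])
    \<comment> \<open>By determinant 1, \<open>(a * x + b) / (c * x + d)\<close> equals
      \<open>a / c - 1 / (c * (c * x + d))\<close>.\<close>
    from filterlim_compose[OF tendsto_inverse_0 this]
    have "((\<lambda>x. a / c - inverse (d + c * x) / c) \<longlongrightarrow> a / c - 0 / c) E"
      by (intro tendsto_intros) (auto simp: c)
    moreover have "\<forall>\<^sub>F x in E. a / c - inverse (d + c * x) / c = C x"
      using CX
    proof eventually_elim
      case (elim x)
      define u where "u = c * x + d"
      have u: "u \<noteq> 0" "C x = (a * x + b) / u" "inverse (d + c * x) = 1 / u"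
        using elim by (simp_all add: u_def add.commute inverse_eq_divide)
      have "a * u - 1 = (a * x + b) * c" unfolding u_def using det by algebra
      then show ?case unfolding u using u(1) c by (simp add: divide_simps mult.commute)
    qed
    ultimately have "(C \<longlongrightarrow> a / c) E" by (simp add: filterlim_cong)
    moreover have "filterlim C at_infinity E"
      using filterlim_mono[OF filterlim_ends[OF C(2,3) _ E'(1)] inf order_refl] by simp
    ultimately show False using not_tendsto_and_filterlim_at_infinity[OF nb] by blast
  qed
  then have "d \<noteq> 0" "a \<noteq> 0" using det by auto
  moreover have "\<forall>\<^sub>F x in E. C x = a / d * x + b / d"
    using CX by eventually_elim (simp add: \<open>c = 0\<close> add_divide_distrib)
  ultimately show ?thesis unfolding aff_germ_def by (intro exI[of _ "a / d"] exI[of _ "b / d"]) auto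
qed

text \<open>The chart sends \<open>p\<close> to infinity, and projective maps fixing infinity are
  affine.\<close>

lemma aff_germ_fixed_point:
  assumes C: "pw_mob C" "isCont C p" "C p = p" and E: "E = at_left p \<or> E = at_right p"
  shows "aff_germ E (\<lambda>x. 1 / (x - p)) C"
proof -
  have E': "E \<in> ends UNIV" using E by (auto simp: ends_def)
  obtain X a b c d where X: "mob_on X C a b c d" "\<forall>\<^sub>F x in E. x \<in> X"
    by (rule pw_mob_at_end[OF C(1) E'])
  have det: "a * d - b * c = 1" using X(1) by (simp add: mob_on_def)
  have CX: "\<forall>\<^sub>F x in E. c * x + d \<noteq> 0 \<and> C x = (a * x + b) / (c * x + d)"
    using X(2) by eventually_elim (use X(1) in \<open>auto simp: mob_on_def\<close>)
  have nb: "E \<noteq> bot" using E by (elim disjE) simp_all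
  have le: "E \<le> at p" using E by (auto intro: at_le)
  have np: "\<forall>\<^sub>F x in E. x \<noteq> p" using E by (auto simp: eventually_at_filter)
  have lim: "((\<lambda>x. x) \<longlongrightarrow> p) E" "(C \<longlongrightarrow> p) E"
    using C(2,3) by (auto simp: isCont_def intro: filterlim_mono[OF _ order_refl le])
  \<comment> \<open>The piece may omit \<open>p\<close>, so limits are needed to see that its matrix
    fixes \<open>p\<close>; the denominator is cleared first as it might vanish at
    \<open>p\<close>.\<close>
  have "((\<lambda>x. C x * (c * x + d)) \<longlongrightarrow> p * (c * p + d)) E" by (intro tendsto_intros lim)
  moreover have "\<forall>\<^sub>F x in E. C x * (c * x + d) = a * x + b"
    using CX by eventually_elim auto
  ultimately have "((\<lambda>x. a * x + b) \<longlongrightarrow> p * (c * p + d)) E" by (simp add: filterlim_cong)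
  moreover have "((\<lambda>x. a * x + b) \<longlongrightarrow> a * p + b) E" by (intro tendsto_intros lim)
  ultimately have fixp: "p * (c * p + d) = a * p + b" using tendsto_unique nb by blast
  \<comment> \<open>\<open>c * p + d\<close> and \<open>a - p * c\<close> are the two eigenvalues of
    the matrix.\<close>
  have one: "(a - p * c) * (c * p + d) = 1" using det fixp by algebra
  then have nz: "c * p + d \<noteq> 0" "a - p * c \<noteq> 0" by auto
  have "\<forall>\<^sub>F x in E. 1 / (C x - p) = (c * p + d)\<^sup>2 * (1 / (x - p)) + c * (c * p + d)"
    using CX np
  proof eventually_elim
    case (elim x)
    have "(a * x + b) - p * (c * x + d) = (a - p * c) * (x - p)" using fixp by algebra
    then have "C x - p = (a - p * c) * (x - p) / (c * x + d)"
      using elim by (simp add: field_simps)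
    then have "1 / (C x - p) = (c * x + d) / ((a - p * c) * (x - p))" by simp
    also have "\<dots> = (c * p + d) * (c * x + d) / (x - p)"
    proof -
      have "1 / (a - p * c) = c * p + d" using one nz by (simp add: field_simps)
      moreover have "(c * x + d) / ((a - p * c) * (x - p)) = 1 / (a - p * c) * (c * x + d) / (x - p)" by simp
      ultimately show ?thesis by simp
    qed
    also have "\<dots> = (c * p + d)\<^sup>2 * (1 / (x - p)) + c * (c * p + d)"
      using elim(2) by (simp add: field_simps power2_eq_square)
    finally show ?case .
  qed
  then show ?thesis unfolding aff_germ_def using nz by (intro exI[of _ "(c * p + d)\<^sup>2"] exI[of _ "c * (c * p + d)"]) auto
qed

text \<open>Fixed points are roots of \<open>c * u * u + (d - a) * u - b\<close>, and a third root
  makes this polynomial vanish.\<close>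

lemma mob_on_three_fixed_points:
  assumes C: "mob_on X C a b c d" and S: "x \<in> X" "y \<in> X" "z \<in> X" "x \<noteq> y" "x \<noteq> z" "y \<noteq> z"
    and fixed: "C x = x" "C y = y" "C z = z" and t: "t \<in> X"
  shows "C t = t"
proof -
  have eq: "c * u * u + (d - a) * u - b = 0 \<longleftrightarrow> C u = u" if "u \<in> X" for u
    using C that by (auto simp: mob_on_def field_simps)
  have e: "c * x * x + (d - a) * x - b = 0" "c * y * y + (d - a) * y - b = 0"
    "c * z * z + (d - a) * z - b = 0"
    using eq S fixed by blast+
  then have "(x - y) * (c * (x + y) + (d - a)) = 0" "(x - z) * (c * (x + z) + (d - a)) = 0" by algebra+
  then have "c * (x + y) + (d - a) = 0" "c * (x + z) + (d - a) = 0" using S by auto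
  then have "c * (y - z) = 0" by algebra
  then have "c = 0" using S by simp
  then have "d - a = 0" "b = 0" using \<open>c * (x + y) + (d - a) = 0\<close> e(1) by auto
  then show ?thesis using eq[OF t] \<open>c = 0\<close> by simp
qed

section \<open>Finiteness of the gaps and the contradiction\<close>

context two_homeos
begin

text \<open>On the overlap of a piece of \<open>F\<close> and one of \<open>G\<close>, three common
  fixed points make both maps the identity, so the rightmost of them is not isolated on its
  left.\<close>

lemma finite_left_isolated:
  assumes "pw_mob F" "pw_mob G"
  shows "finite left_isolated"
proof -
  obtain \<X> where \<X>: "finite \<X>" "\<Union>\<X> = UNIV"
    "\<forall>X\<in>\<X>. is_interval X \<and> (\<exists>a b c d. mob_on X F a b c d)"
    using assms(1) unfolding pw_mob_def by (elim exE conjE)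
  obtain \<Y> where \<Y>: "finite \<Y>" "\<Union>\<Y> = UNIV"
    "\<forall>X\<in>\<Y>. is_interval X \<and> (\<exists>a b c d. mob_on X G a b c d)"
    using assms(2) unfolding pw_mob_def by (elim exE conjE)
  have "finite (left_isolated \<inter> (X \<inter> Y))" if XY: "X \<in> \<X>" "Y \<in> \<Y>" for X Y
  proof (rule ccontr)
    assume "infinite (left_isolated \<inter> (X \<inter> Y))"
    then obtain S where S: "S \<subseteq> left_isolated \<inter> (X \<inter> Y)" "finite S" "card S = 3"
      using infinite_arbitrarily_large by metis
    define z where "z = Max S"
    have z: "z \<in> S" unfolding z_def using S by (intro Max_in) auto
    then have "card (S - {z}) = 2" using S by simp
    then obtain x y where xy: "S - {z} = {x, y}" "x \<noteq> y" unfolding card_2_iff by blast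
    then have "x \<in> S - {z}" "y \<in> S - {z}" by simp_all
    then have "x \<in> S" "y \<in> S" "x \<noteq> z" "y \<noteq> z" by simp_all
    then have "x < z" using Max_ge[OF S(2), of x] by (simp add: z_def order_le_less)
    have mem: "x \<in> X \<inter> Y" "y \<in> X \<inter> Y" "z \<in> X \<inter> Y" "x \<in> Fix" "y \<in> Fix" "z \<in> left_isolated" "z \<in> Fix"
      using subsetD[OF S(1) z] subsetD[OF S(1) \<open>x \<in> S\<close>] subsetD[OF S(1) \<open>y \<in> S\<close>]
      by (simp_all add: left_isolated_def)
    obtain e where e: "e < z" "{e<..<z} \<inter> Fix = {}" using mem(6) by (auto simp: left_isolated_def)
    \<comment> \<open>A point \<open>t\<close> chosen here lies between \<open>x\<close> and
      \<open>z\<close>, hence in the overlap, and also in the part left of \<open>z\<close> without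
      common fixed points.\<close>
    have "max e x < z" using e(1) \<open>x < z\<close> by simp
    then obtain t where t: "max e x < t" "t < z" using dense by blast
    then have et: "e < t" "x \<le> t" "t \<le> z" by simp_all
    have int: "is_interval X" "is_interval Y" using \<X>(3) \<Y>(3) XY by simp_all
    have tX: "t \<in> X" "t \<in> Y"
      using mem_is_interval_1_I[OF int(1), of x z t] mem_is_interval_1_I[OF int(2), of x z t]
        mem(1,3) et by simp_all
    obtain a b c d where "mob_on X F a b c d" using \<X>(3) XY by blast
    then have "F t = t"
      by (rule mob_on_three_fixed_points[of X F a b c d x y z])
        (use mem xy(2) \<open>x \<noteq> z\<close> \<open>y \<noteq> z\<close> tX in \<open>simp_all add: Fix_def\<close>)
    moreover obtain a b c d where "mob_on Y G a b c d" using \<Y>(3) XY by blast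
    then have "G t = t"
      by (rule mob_on_three_fixed_points[of Y G a b c d x y z])
        (use mem xy(2) \<open>x \<noteq> z\<close> \<open>y \<noteq> z\<close> tX in \<open>simp_all add: Fix_def\<close>)
    ultimately have "t \<in> Fix" by (simp add: Fix_def)
    moreover have "t \<in> {e<..<z}" using et(1) t(2) by simp
    ultimately show False using e(2) by blast
  qed
  then have "finite (\<Union>X\<in>\<X>. \<Union>Y\<in>\<Y>. left_isolated \<inter> (X \<inter> Y))"
    using \<X>(1) \<Y>(1) by (intro finite_UN_I)
  moreover have "left_isolated \<subseteq> (\<Union>X\<in>\<X>. \<Union>Y\<in>\<Y>. left_isolated \<inter> (X \<inter> Y))"
  proof
    fix x assume "x \<in> left_isolated"
    moreover obtain X Y where "X \<in> \<X>" "x \<in> X" "Y \<in> \<Y>" "x \<in> Y" using \<X>(2) \<Y>(2) by blast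
    ultimately show "x \<in> (\<Union>X\<in>\<X>. \<Union>Y\<in>\<Y>. left_isolated \<inter> (X \<inter> Y))" by auto
  qed
  ultimately show ?thesis by (rule rev_finite_subset)
qed

lemma not_free_pair:
  assumes "pw_mob F" "pw_mob G"
  shows "\<not> free_pair F G"
proof
  assume free: "free_pair F G"
  have "germ_trivial double_commutator"
  proof (rule germ_trivial_double_commutator)
    fix E assume "E \<in> ends Fix"
    then consider "E = at_top \<or> E = at_bot" | p where "p \<in> Fix" "E = at_left p \<or> E = at_right p"
      by (auto simp: ends_def)
    then show "\<exists>\<phi>. inj \<phi> \<and> aff_germ E \<phi> F \<and> aff_germ E \<phi> G"
    proof cases
      case 1
      then show ?thesis
        by (intro exI[of _ "\<lambda>x. x"] conjI aff_germ_infinity assms mono_F mono_G surj_F surj_G) auto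
    next
      case 2
      \<comment> \<open>At \<open>p\<close> the chart takes the default value
        \<open>1 / 0 = 0\<close>, which it takes nowhere else.\<close>
      have "inj (\<lambda>x. 1 / (x - p))" by (rule injI) (auto simp: divide_inverse)
      then show ?thesis using 2
        by (intro exI[of _ "\<lambda>x. 1 / (x - p)"] conjI aff_germ_fixed_point assms
            strict_mono_surj_isCont mono_F mono_G surj_F surj_G) (auto simp: Fix_def)
    qed
  qed
  moreover have "W double_commutator \<noteq> id"
    using free reduced_double_commutator by (auto simp: free_pair_def)
  ultimately show False
    using germ_trivial_free_False[OF free finite_left_isolated[OF assms]] by blast
qed

end

section \<open>From the projective line to the real line\<close>

lemma istopology_P1_open: "istopology P1_open"
  unfolding istopology_def
proof (intro conjI allI impI)
  fix S T assume S: "P1_open S" and T: "P1_open T"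
  have "{x. Some x \<in> S \<inter> T} = {x. Some x \<in> S} \<inter> {x. Some x \<in> T}" by auto
  then have "open {x. Some x \<in> S \<inter> T}" using S T by (simp add: P1_open_def open_Int)
  moreover have "\<exists>R. \<forall>x. R < \<bar>x\<bar> \<longrightarrow> Some x \<in> S \<inter> T" if None: "None \<in> S \<inter> T"
  proof -
    obtain R R' where "\<forall>x. R < \<bar>x\<bar> \<longrightarrow> Some x \<in> S" "\<forall>x. R' < \<bar>x\<bar> \<longrightarrow> Some x \<in> T"
      using None S T by (auto simp: P1_open_def)
    then show ?thesis by (intro exI[of _ "max R R'"]) auto
  qed
  ultimately show "P1_open (S \<inter> T)" by (simp add: P1_open_def)
next
  fix \<K> assume K: "\<forall>K\<in>\<K>. P1_open K"
  have "{x. Some x \<in> \<Union>\<K>} = (\<Union>K\<in>\<K>. {x. Some x \<in> K})" by auto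
  moreover have "open (\<Union>K\<in>\<K>. {x. Some x \<in> K})" using K by (auto simp: P1_open_def)
  ultimately have "open {x. Some x \<in> \<Union>\<K>}" by simp
  moreover have "\<exists>R. \<forall>x. R < \<bar>x\<bar> \<longrightarrow> Some x \<in> \<Union>\<K>" if None: "None \<in> \<Union>\<K>"
  proof -
    obtain K where "K \<in> \<K>" "None \<in> K" using None by blast
    then obtain R where "\<forall>x. R < \<bar>x\<bar> \<longrightarrow> Some x \<in> K" using K by (auto simp: P1_open_def)
    then show ?thesis using \<open>K \<in> \<K>\<close> by blast
  qed
  ultimately show "P1_open (\<Union>\<K>)" by (simp add: P1_open_def)
qed

lemma openin_P1_top: "openin P1_top U \<longleftrightarrow> P1_open U"
  by (simp add: P1_top_def topology_inverse'[OF istopology_P1_open])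

lemma topspace_P1_top [simp]: "topspace P1_top = UNIV"
proof -
  have "openin P1_top UNIV" by (simp add: openin_P1_top P1_open_def)
  then show ?thesis using openin_subset by blast
qed

lemma P1_open_Some_image: "P1_open (Some ` U) \<longleftrightarrow> open U"
proof -
  have "{x. Some x \<in> Some ` U} = U" by auto
  then show ?thesis by (auto simp: P1_open_def)
qed

text \<open>An arc missing infinity is disconnected by any omitted point between two of its points;
  for an arc through infinity, two omitted points with one of its points between them cut the circle
  apart.\<close>

lemma connectedin_P1_interval:
  assumes I: "connectedin P1_top I"
  shows "is_interval {x. Some x \<in> I} \<or> is_interval {x. Some x \<notin> I}"
proof (cases "None \<in> I")
  case False
  have "Some z \<in> I" if xy: "Some x \<in> I" "Some y \<in> I" "x \<le> z" "z \<le> y" for x y z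
  proof (rule ccontr)
    assume z: "Some z \<notin> I"
    then have "x < z" "z < y" using xy by (auto simp: order_le_less)
    have "openin P1_top (Some ` {..<z})" "openin P1_top (Some ` {z<..})"
      by (simp_all add: openin_P1_top P1_open_Some_image)
    moreover have "I \<subseteq> Some ` {..<z} \<union> Some ` {z<..}"
    proof
      fix p assume p: "p \<in> I"
      with False obtain t where t: "p = Some t" by (cases p) auto
      with p z have "t \<noteq> z" by auto
      then have "t < z \<or> z < t" by (simp add: neq_iff)
      with t show "p \<in> Some ` {..<z} \<union> Some ` {z<..}" by auto
    qed
    moreover have "Some ` {..<z} \<inter> Some ` {z<..} \<inter> I = {}" by auto
    moreover have "Some x \<in> Some ` {..<z} \<inter> I" "Some y \<in> Some ` {z<..} \<inter> I"
      using xy \<open>x < z\<close> \<open>z < y\<close> by auto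
    ultimately show False using I unfolding connectedin by blast
  qed
  then show ?thesis unfolding is_interval_1 by blast
next
  case True
  have "Some z \<notin> I" if xy: "Some x \<notin> I" "Some y \<notin> I" "x \<le> z" "z \<le> y" for x y z
  proof
    assume z: "Some z \<in> I"
    then have "x < z" "z < y" using xy by (auto simp: order_le_less)
    have "openin P1_top (Some ` {x<..<y})"
      by (simp add: openin_P1_top P1_open_Some_image)
    moreover have "openin P1_top (- Some ` {x..y})"
    proof -
      have "{t. Some t \<in> - Some ` {x..y}} = - {x..y}" by auto
      then have "open {t. Some t \<in> - Some ` {x..y}}" by (simp add: open_Compl)
      moreover have "Some t \<in> - Some ` {x..y}" if "\<bar>x\<bar> + \<bar>y\<bar> < \<bar>t\<bar>" for t
        using that by auto
      ultimately show ?thesis by (auto simp: openin_P1_top P1_open_def)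
    qed
    moreover have "I \<subseteq> Some ` {x<..<y} \<union> - Some ` {x..y}"
    proof
      fix p assume "p \<in> I"
      with xy show "p \<in> Some ` {x<..<y} \<union> - Some ` {x..y}"
        by (auto simp: order_le_less)
    qed
    moreover have "Some ` {x<..<y} \<inter> - Some ` {x..y} \<inter> I = {}" by auto
    moreover have "Some z \<in> Some ` {x<..<y} \<inter> I" "None \<in> - Some ` {x..y} \<inter> I"
      using z True \<open>x < z\<close> \<open>z < y\<close> by auto
    ultimately show False using I unfolding connectedin by blast
  qed
  then show ?thesis unfolding is_interval_1 by blast
qed

text \<open>An arc through infinity leaves up to two intervals of the line; they are separated by
  cutting at a point outside \<open>X\<close>.\<close>

lemma coconvex_split:
  fixes X :: "real set"
  assumes "is_interval X \<or> is_interval (- X)"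
  shows "\<exists>\<Y>. finite \<Y> \<and> \<Union>\<Y> = X \<and> (\<forall>Y\<in>\<Y>. is_interval Y)"
proof (cases "is_interval X")
  case True
  then show ?thesis by (intro exI[of _ "{X}"]) auto
next
  case False
  then have int: "is_interval (- X)" using assms by blast
  have "X \<noteq> UNIV" using False by auto
  then obtain c where c: "c \<notin> X" by blast
  have "z \<in> X" if "x \<in> X" "y \<in> X" "x \<le> z" "z \<le> y" "y \<le> c \<or> c \<le> x" for x y z
    using mem_is_interval_1_I[OF int, of z c y] mem_is_interval_1_I[OF int, of c z x] c that by auto
  then have "is_interval (X \<inter> {..c})" "is_interval (X \<inter> {c..})"
    unfolding is_interval_1 by auto
  moreover have "\<Union>{X \<inter> {..c}, X \<inter> {c..}} = X" by auto
  ultimately show ?thesis by (intro exI[of _ "{X \<inter> {..c}, X \<inter> {c..}}"]) auto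
qed

lemma pw_mob_of_pieces:
  fixes F :: "real \<Rightarrow> real"
  assumes F: "\<And>x. f (Some x) = Some (F x)"
    and fin: "finite \<I>" and cover: "\<Union>\<I> = UNIV"
    and pieces: "\<forall>I\<in>\<I>. connectedin P1_top I \<and>
      (\<exists>a b c d. a * d - b * c = 1 \<and> (\<forall>x\<in>I. f x = mob a b c d x))"
  shows "pw_mob F"
proof -
  have "\<forall>I\<in>\<I>. \<exists>\<Y>. finite \<Y> \<and> \<Union>\<Y> = {x. Some x \<in> I} \<and> (\<forall>Y\<in>\<Y>. is_interval Y)"
  proof
    fix I assume "I \<in> \<I>"
    have "- {x. Some x \<in> I} = {x. Some x \<notin> I}" by auto
    moreover have "connectedin P1_top I" using pieces \<open>I \<in> \<I>\<close> by simp
    ultimately show "\<exists>\<Y>. finite \<Y> \<and> \<Union>\<Y> = {x. Some x \<in> I} \<and> (\<forall>Y\<in>\<Y>. is_interval Y)"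
      using connectedin_P1_interval[of I] coconvex_split[of "{x. Some x \<in> I}"] by simp
  qed
  from bchoice[OF this] obtain \<Y> where \<Y>: "\<forall>I\<in>\<I>. finite (\<Y> I) \<and>
    \<Union>(\<Y> I) = {x. Some x \<in> I} \<and> (\<forall>Y\<in>\<Y> I. is_interval Y)"
    by (rule exE)
  have mob: "\<exists>a b c d. mob_on Y F a b c d" if I: "I \<in> \<I>" "Y \<in> \<Y> I" for I Y
  proof -
    obtain a b c d where abcd: "a * d - b * c = 1" "\<forall>x\<in>I. f x = mob a b c d x"
      using pieces I(1) by meson
    have "c * x + d \<noteq> 0 \<and> F x = (a * x + b) / (c * x + d)" if "x \<in> Y" for x
    proof -
      have "\<Union>(\<Y> I) = {x. Some x \<in> I}" using \<Y> I(1) by simp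
      then have "Some x \<in> I" using I(2) that by blast
      then have "mob a b c d (Some x) = Some (F x)" using abcd(2) F[of x] by simp
      \<comment> \<open>That the value is finite rules out the pole.\<close>
      then show ?thesis by (auto simp: mob_def split: if_splits)
    qed
    then have "mob_on Y F a b c d" using abcd(1) by (simp add: mob_on_def)
    then show ?thesis by (intro exI)
  qed
  have "x \<in> \<Union>(\<Union>I\<in>\<I>. \<Y> I)" for x
  proof -
    have "Some x \<in> \<Union>\<I>" using cover by simp
    then obtain I where I: "I \<in> \<I>" "Some x \<in> I" by (rule UnionE)
    have "\<Union>(\<Y> I) = {x. Some x \<in> I}" using \<Y> I(1) by simp
    then have "x \<in> \<Union>(\<Y> I)" using I(2) by simp
    with \<open>I \<in> \<I>\<close> show ?thesis by (simp add: bexI)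
  qed
  then have "\<Union>(\<Union>I\<in>\<I>. \<Y> I) = UNIV" by (intro UNIV_eq_I[symmetric])
  moreover have "finite (\<Union>I\<in>\<I>. \<Y> I)" using fin \<Y> by simp
  moreover have "\<forall>Y\<in>(\<Union>I\<in>\<I>. \<Y> I). is_interval Y \<and> (\<exists>a b c d. mob_on Y F a b c d)"
    using mob \<Y> by simp
  ultimately show ?thesis unfolding pw_mob_def by (intro exI[of _ "\<Union>I\<in>\<I>. \<Y> I"] conjI)
qed

lemma continuous_on_of_P1:
  assumes f: "continuous_map P1_top P1_top f" and F: "\<And>x. f (Some x) = Some (F x)"
  shows "continuous_on UNIV F"
  unfolding continuous_on_open_vimage[OF open_UNIV]
proof (intro allI impI)
  fix B :: "real set" assume "open B"
  then have "openin P1_top (Some ` B)" by (simp add: openin_P1_top P1_open_Some_image)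
  then have "openin P1_top {p \<in> topspace P1_top. f p \<in> Some ` B}"
    by (rule openin_continuous_map_preimage[OF f])
  then have "open {x. f (Some x) \<in> Some ` B}" by (simp add: openin_P1_top P1_open_def)
  also have "{x. f (Some x) \<in> Some ` B} = F -` B \<inter> UNIV" by (auto simp: F)
  finally show "open (F -` B \<inter> UNIV)" .
qed

lemma H_real:
  assumes f: "f \<in> H"
  obtains F where "bij f" "\<And>x. f (Some x) = Some (F x)" "f None = None"
    "strict_mono F" "surj F" "pw_mob F"
proof -
  have hom: "homeomorphic_map P1_top P1_top f" and None: "f None = None"
    using f by (simp_all add: H_def G_def)
  have bij: "bij f"
    using homeomorphic_imp_injective_map[OF hom] homeomorphic_imp_surjective_map[OF hom]
    by (simp add: bij_def)
  \<comment> \<open>\<open>the\<close> is never applied to \<open>None\<close>: injectivity reserves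
    that value for the fixed point at infinity.\<close>
  define F where "F = (\<lambda>x. the (f (Some x)))"
  note inj_f = inj_eq[OF bij_is_inj[OF bij]]
  have F: "f (Some x) = Some (F x)" for x
    using inj_f[of "Some x" None] None by (simp add: F_def)
  have inj: "inj F"
  proof (rule injI)
    fix x y assume "F x = F y"
    then have "f (Some x) = f (Some y)" by (simp only: F)
    then show "x = y" by (simp add: inj_f)
  qed
  have surj: "surj F"
  proof (rule surjI)
    fix y
    have y: "f (inv f (Some y)) = Some y" by (simp add: surj_f_inv_f bij_is_surj[OF bij])
    then obtain x where "inv f (Some y) = Some x" using None by (cases "inv f (Some y)") auto
    with y F[of x] show "F (the (inv f (Some y))) = y" by simp
  qed
  have "\<exists>\<I>. finite \<I> \<and> \<Union>\<I> = UNIV \<and> (\<forall>I\<in>\<I>. connectedin P1_top I \<and>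
      (\<exists>a b c d. a * d - b * c = 1 \<and> (\<forall>x\<in>I. f x = mob a b c d x)))"
    using f by (simp add: H_def G_def)
  then have pw: "pw_mob F" by (elim exE conjE) (rule pw_mob_of_pieces[of f F, OF F])
  have "continuous_on UNIV F"
    by (rule continuous_on_of_P1[of f F, OF homeomorphic_imp_continuous_map[OF hom] F])
  with pw have "strict_mono F" using inj by (rule pw_mob_strict_mono)
  from bij F None this surj pw show ?thesis by (rule that)
qed

text \<open>As \<open>f\<close> and \<open>g\<close> differ, renaming the letters is injective and
  keeps words reduced.\<close>

lemma free_basis_free_pair:
  assumes S: "free_basis S" and fg: "f \<in> S" "g \<in> S" "f \<noteq> g" and bij: "bij f" "bij g"
  shows "free_pair f g"
  unfolding free_pair_def
proof (intro conjI allI impI bij)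
  fix w :: "(bool \<times> bool) list" assume w: "w \<noteq> [] \<and> reduced w"
  define h where "h = (\<lambda>(i, e :: bool). (if i then f else g, e))"
  have fst_eq: "fst (h x) = fst (h y) \<longleftrightarrow> fst x = fst y" and snd_eq: "snd (h x) = snd x" for x y
    using fg(3) by (auto simp: h_def split: prod.splits)
  have "reduced_word (map h w)" if "reduced w" for w
    using that by (induction w rule: reduced.induct) (auto simp: fst_eq snd_eq)
  moreover have "fst ` set (map h w) \<subseteq> S" using fg by (auto simp: h_def)
  ultimately show "ev f g w \<noteq> id"
    using w S unfolding free_basis_def ev_def h_def[symmetric] by simp
qed

lemma ev_Some:
  fixes F G :: "'a \<Rightarrow> 'a"
  assumes f: "bij f" "\<And>x. f (Some x) = Some (F x)" "f None = None" "surj F"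
    and g: "bij g" "\<And>x. g (Some x) = Some (G x)" "g None = None" "surj G"
  shows "ev f g w (Some x) = Some (ev F G w x) \<and> ev f g w None = None"
proof -
  have inv: "inv h (Some x) = Some (inv K x) \<and> inv h None = None"
    if "bij h" "\<And>x. h (Some x) = Some (K x)" "h None = None" "surj K" for h K and x :: 'a
    by (intro conjI inv_f_eq bij_is_inj that(1,3)) (simp add: that(2) surj_f_inv_f that(4))
  show ?thesis
    by (induction w) (auto simp: ev_Cons f g inv[of f F, OF f] inv[of g G, OF g])
qed

lemma H_no_free_subgroup: "\<not> has_nonabelian_free_subgroup H"
proof
  assume "has_nonabelian_free_subgroup H"
  then obtain S f g where S: "S \<subseteq> H" "free_basis S" and fg: "f \<in> S" "g \<in> S" "f \<noteq> g"
    unfolding has_nonabelian_free_subgroup_def by blast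
  obtain F where F: "bij f" "\<And>x. f (Some x) = Some (F x)" "f None = None"
    "strict_mono F" "surj F" "pw_mob F"
    using H_real[of f] subsetD[OF S(1) fg(1)] by metis
  obtain G where G: "bij g" "\<And>x. g (Some x) = Some (G x)" "g None = None"
    "strict_mono G" "surj G" "pw_mob G"
    using H_real[of g] subsetD[OF S(1) fg(2)] by metis
  interpret two_homeos F G by unfold_locales (rule F G)+
  have fp: "free_pair f g" by (rule free_basis_free_pair[OF S(2) fg F(1) G(1)])
  have ev: "ev f g w (Some x) = Some (W w x) \<and> ev f g w None = None" for w x
    by (intro ev_Some F(1-3,5) G(1-3,5))
  \<comment> \<open>Infinity is fixed, so a word trivial on the line is trivial on the projective
    line.\<close>
  have "W w \<noteq> id" if "w \<noteq> []" "reduced w" for w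
  proof
    assume "W w = id"
    then have "ev f g w p = p" for p using ev[of w] by (cases p) simp_all
    then have "ev f g w = id" by (simp add: fun_eq_iff)
    then show False using fp that by (simp add: free_pair_def)
  qed
  then have "free_pair F G" by (simp add: free_pair_def bij_FG)
  with not_free_pair[OF F(6) G(6)] show False by (rule notE)
qed

theorem theorem2:
  shows "\<not> has_nonabelian_free_subgroup H \<and>
         (\<forall>A. is_subring A \<longrightarrow> \<not> has_nonabelian_free_subgroup (H_ring A))"
proof (intro conjI allI impI)
  fix A
  have "H_ring A \<subseteq> H" by (simp add: H_ring_def)
  then show "\<not> has_nonabelian_free_subgroup (H_ring A)"
    using H_no_free_subgroup unfolding has_nonabelian_free_subgroup_def by (blast intro: subset_trans)
qed (rule H_no_free_subgroup)

end
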